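(* Let $n\ge 1$ and $d\ge 3$ be integers and let $f\in\mathbb{C}[x_1,\dots,x_n]$ be a nondegenerate form (homogeneous polynomial) of degree $d$ with center $Z(f)\subset\mathbb{C}^{n\times n}$. Let $D$ denote the subalgebra of $\mathbb{C}^{n\times n}$ consisting of all diagonal matrices. Then the following statements are equivalent: \begin{enumerate} \item[(1)] The form $f$ is diagonalizable. \item[(2)] $Z(f)\cong D$ (as $\mathbb{C}$-algebras). \item[(3)] $f$ is smooth and $\dim Z(f)=n$. \item[(4)] $Z(f)$ is semisimple and $\dim Z(f)=n$. \item[(5)] $\dim Z(f)=n$ and any basis of $Z(f)$ consists of diagonalizable matrices. \item[(6)] $\dim Z(f)=n$ and $Z(f)$ has a basis consisting of rank $1$ and trace $1$ matrices. \end{enumerate}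
   Context: The ground field is $\mathbb{C}$ and $d\ge 3$. Write a degree $d$ form symmetrically as $f=\sum_{1\le i_1,\dots,i_d\le n}a_{i_1\cdots i_d}x_{i_1}\cdots x_{i_d}$ with $a_{i_1\cdots i_d}$ symmetric in the indices; $A=(a_{i_1\cdots i_d})$ is its Gram tensor, and $A^{(i_3\cdots i_d)}$ denotes the $n\times n$ matrix $(a_{i_1i_2i_3\cdots i_d})_{1\le i_1,i_2\le n}$. Let $H=\left(\frac{\partial^2 f}{\partial x_i\partial x_j}\right)_{1\le i,j\le n}$ be the Hessian matrix of $f$. The center of $f$ is $Z(f)=\{X\in\mathbb{C}^{n\times n}\mid (HX)^T=HX\}=\{X\in\mathbb{C}^{n\times n}\mid X^TA^{(i_3\cdots i_d)}=A^{(i_3\cdots i_d)}X\ \text{for all } 1\le i_3,\dots,i_d\le n\}$. For a nondegenerate form of degree $d\ge 3$, it is a commutative subalgebra of $\mathbb{C}^{n\times n}$. All dimensions are over $\mathbb{C}$. The form $f$ is nondegenerate if no variable can be removed by an invertible linear change of variables, i.e. there is no $P\in\mathrm{GL}(n,\mathbb{C})$ such that after the substitution $x=Py$ the resulting form involves fewer than $n$ variables. The form $f$ is diagonalizable if $f=\sum_{i=1}^r\lambda_i\, l_i(x_1,\dots,x_n)^d$ for some $r$, with nonzero $\lambda_i\in\mathbb{C}$ and linearly independent linear forms $l_1,\dots,l_r$ over $\mathbb{C}$. The form $f$ is smooth if the system $\frac{\partial f}{\partial x_1}=\cdots=\frac{\partial f}{\partial x_n}=0$ has no nonzero solution in $\mathbb{C}^n$.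 *)

theory Defs
  imports "HOL-Analysis.Analysis" "HOL-Library.Poly_Mapping"
begin

section \<open>Polynomials with complex coefficients\<close>

text \<open>
  A polynomial in the variables \<open>x\<^sub>i\<close>, \<open>i :: 'n\<close>, is a finitely supported map from exponent
  vectors \<open>m :: 'n \<Rightarrow>\<^sub>0 nat\<close> to coefficients; multiplication is the convolution product supplied by
  \<^theory>\<open>HOL-Library.Poly_Mapping\<close>. The number of variables is \<open>CARD('n)\<close>, which is positive.
\<close>

type_synonym 'n cpoly = "('n \<Rightarrow>\<^sub>0 nat) \<Rightarrow>\<^sub>0 complex"

definition const_poly :: "complex \<Rightarrow> 'n cpoly" where
  "const_poly c = Poly_Mapping.single 0 c"

definition var_poly :: "'n \<Rightarrow> 'n cpoly" where
  "var_poly i = Poly_Mapping.single (Poly_Mapping.single i 1) 1"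

definition homogeneous :: "nat \<Rightarrow> 'n::finite cpoly \<Rightarrow> bool" where
  "homogeneous d f \<longleftrightarrow>
     (\<forall>m \<in> Poly_Mapping.keys f. (\<Sum>i\<in>UNIV. Poly_Mapping.lookup m i) = d)"

definition occurring_vars :: "'n cpoly \<Rightarrow> 'n set" where
  "occurring_vars f = (\<Union>m \<in> Poly_Mapping.keys f. Poly_Mapping.keys m)"

definition eval_poly :: "'n::finite cpoly \<Rightarrow> complex^'n \<Rightarrow> complex" where
  "eval_poly f v =
     (\<Sum>m \<in> Poly_Mapping.keys f.
        Poly_Mapping.lookup f m * (\<Prod>i\<in>UNIV. (v $ i) ^ Poly_Mapping.lookup m i))"

definition subst_poly :: "('n \<Rightarrow> 'n cpoly) \<Rightarrow> 'n::finite cpoly \<Rightarrow> 'n cpoly" where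
  "subst_poly g f =
     (\<Sum>m \<in> Poly_Mapping.keys f.
        const_poly (Poly_Mapping.lookup f m) * (\<Prod>i\<in>UNIV. g i ^ Poly_Mapping.lookup m i))"

text \<open>
  Termwise formal partial derivative. If \<open>x\<^sub>i\<close> does not occur in the monomial \<open>m\<close>, the truncated
  subtraction is harmless because the coefficient is \<open>0\<close>.
\<close>

definition partial_deriv :: "'n \<Rightarrow> 'n cpoly \<Rightarrow> 'n cpoly" where
  "partial_deriv i f =
     (\<Sum>m \<in> Poly_Mapping.keys f.
        Poly_Mapping.single (m - Poly_Mapping.single i 1)
          (of_nat (Poly_Mapping.lookup m i) * Poly_Mapping.lookup f m))"

section \<open>Properties of forms\<close>

text \<open>The form obtained from \<open>f\<close> by the substitution \<open>x = P y\<close>.\<close>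

definition linear_subst :: "complex^'n^'n \<Rightarrow> 'n::finite cpoly \<Rightarrow> 'n cpoly" where
  "linear_subst P f = subst_poly (\<lambda>i. \<Sum>j\<in>UNIV. const_poly (P $ i $ j) * var_poly j) f"

definition nondegenerate :: "'n::finite cpoly \<Rightarrow> bool" where
  "nondegenerate f \<longleftrightarrow>
     \<not> (\<exists>P :: complex^'n^'n. invertible P \<and> card (occurring_vars (linear_subst P f)) < CARD('n))"

text \<open>The linear forms \<open>l 0, \<dots>, l (r - 1)\<close> are linearly independent as a family.\<close>

definition lin_indep_forms :: "nat \<Rightarrow> (nat \<Rightarrow> 'n::finite cpoly) \<Rightarrow> bool" where
  "lin_indep_forms r l \<longleftrightarrow>
     (\<forall>i<r. homogeneous 1 (l i)) \<and>
     (\<forall>c. (\<Sum>i<r. const_poly (c i) * l i) = 0 \<longrightarrow> (\<forall>i<r. c i = 0))"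

definition diagonalizable_form :: "nat \<Rightarrow> 'n::finite cpoly \<Rightarrow> bool" where
  "diagonalizable_form d f \<longleftrightarrow>
     (\<exists>r lam l. (\<forall>i<r. lam i \<noteq> 0) \<and> lin_indep_forms r l \<and>
        f = (\<Sum>i<r. const_poly (lam i) * l i ^ d))"

definition smooth_form :: "'n::finite cpoly \<Rightarrow> bool" where
  "smooth_form f \<longleftrightarrow> (\<forall>v. (\<forall>i. eval_poly (partial_deriv i f) v = 0) \<longrightarrow> v = 0)"

definition hessian :: "'n::finite cpoly \<Rightarrow> ('n cpoly)^'n^'n" where
  "hessian f = (\<chi> i j. partial_deriv i (partial_deriv j f))"

definition const_matrix :: "complex^'n^'n \<Rightarrow> ('n::finite cpoly)^'n^'n" where
  "const_matrix X = (\<chi> i j. const_poly (X $ i $ j))"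

definition center :: "'n::finite cpoly \<Rightarrow> (complex^'n^'n) set" where
  "center f = {X. transpose (hessian f ** const_matrix X) = hessian f ** const_matrix X}"

section \<open>Matrix algebras over the complex numbers\<close>

text \<open>
  The type \<open>complex^'n^'n\<close> carries only a real vector space structure in the library, so its
  complex one is introduced here. The names \<open>cmat.span\<close>, \<open>cmat.dim\<close>, \<open>cmat.independent\<close>, \<dots> all
  refer to complex scalars.
\<close>

definition cmat_scale :: "complex \<Rightarrow> complex^'n^'n \<Rightarrow> complex^'n^'n" where
  "cmat_scale c A = (\<chi> i j. c * A $ i $ j)"

global_interpretation cmat: vector_space "cmat_scale :: complex \<Rightarrow> complex^'n::finite^'n \<Rightarrow> _"
  by unfold_locales (simp_all add: cmat_scale_def vec_eq_iff algebra_simps)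

definition cmat_basis :: "(complex^'n::finite^'n) set \<Rightarrow> (complex^'n^'n) set \<Rightarrow> bool" where
  "cmat_basis B V \<longleftrightarrow> B \<subseteq> V \<and> cmat.independent B \<and> cmat.span B = V"

definition is_diagonal :: "complex^'n^'n \<Rightarrow> bool" where
  "is_diagonal X \<longleftrightarrow> (\<forall>i j. i \<noteq> j \<longrightarrow> X $ i $ j = 0)"

definition diagonal_algebra :: "(complex^'n^'n) set" where
  "diagonal_algebra = {X. is_diagonal X}"

definition diagonalizable_matrix :: "complex^'n::finite^'n \<Rightarrow> bool" where
  "diagonalizable_matrix X \<longleftrightarrow>
     (\<exists>P :: complex^'n^'n. invertible P \<and> is_diagonal (matrix_inv P ** X ** P))"

text \<open>Isomorphism of unital \<open>\<complex>\<close>-algebras; \<open>A\<close> and \<open>B\<close> are meant to be unital subalgebras.\<close>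

definition cmat_alg_isomorphic ::
  "(complex^'n::finite^'n) set \<Rightarrow> (complex^'n^'n) set \<Rightarrow> bool" where
  "cmat_alg_isomorphic A B \<longleftrightarrow>
     (\<exists>\<phi>. bij_betw \<phi> A B \<and> \<phi> (mat 1) = mat 1 \<and>
        (\<forall>X\<in>A. \<forall>Y\<in>A. \<phi> (X + Y) = \<phi> X + \<phi> Y) \<and>
        (\<forall>X\<in>A. \<forall>Y\<in>A. \<phi> (X ** Y) = \<phi> X ** \<phi> Y) \<and>
        (\<forall>c. \<forall>X\<in>A. \<phi> (cmat_scale c X) = cmat_scale c (\<phi> X)))"

definition left_ideal_of :: "(complex^'n::finite^'n) set \<Rightarrow> (complex^'n^'n) set \<Rightarrow> bool" where
  "left_ideal_of A L \<longleftrightarrow> L \<subseteq> A \<and> cmat.subspace L \<and> (\<forall>X\<in>A. \<forall>Y\<in>L. X ** Y \<in> L)"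

text \<open>The left ideals of \<open>A\<close> that are simple as \<open>A\<close>-modules.\<close>

definition minimal_left_ideal_of ::
  "(complex^'n::finite^'n) set \<Rightarrow> (complex^'n^'n) set \<Rightarrow> bool" where
  "minimal_left_ideal_of A L \<longleftrightarrow>
     left_ideal_of A L \<and> L \<noteq> {0} \<and>
     (\<forall>K. left_ideal_of A K \<and> K \<subseteq> L \<longrightarrow> K = {0} \<or> K = L)"

text \<open>
  An algebra is semisimple if its regular module is a direct sum of simple submodules. The sum is
  taken to be finite, which is no restriction for a finite-dimensional algebra.
\<close>

definition semisimple_algebra :: "(complex^'n::finite^'n) set \<Rightarrow> bool" where
  "semisimple_algebra A \<longleftrightarrow>
     (\<exists>(k::nat) L. (\<forall>i<k. minimal_left_ideal_of A (L i)) \<and>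
        A = {\<Sum>i<k. Y i | Y. \<forall>i<k. Y i \<in> L i} \<and>
        (\<forall>Y. (\<forall>i<k. Y i \<in> L i) \<and> (\<Sum>i<k. Y i) = 0 \<longrightarrow> (\<forall>i<k. Y i = 0)))"

end

theory Submission
  imports Defs "HOL-Computational_Algebra.Fundamental_Theorem_Algebra"
begin

text \<open>
  Write \<open>D w f\<close> for the derivative of \<open>f\<close> in direction \<open>w\<close>. A matrix \<open>X\<close> lies in the center
  iff \<open>D (X u) (D v f) = D u (D (X v) f)\<close> for all \<open>u, v\<close>; as \<open>d \<ge> 3\<close>, differentiating once more
  moves \<open>X\<close> freely between three arguments, so nondegeneracy makes \<open>Z(f)\<close> a commutative algebra.

  Everything is reduced to the existence of \<open>n\<close> orthogonal nonzero idempotents \<open>e\<^sub>i\<close> in \<open>Z(f)\<close>.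
  Given these, vectors \<open>u\<^sub>i\<close> in their ranges satisfy \<open>D u\<^sub>i (D u\<^sub>j f) = 0\<close> for \<open>i \<noteq> j\<close>, and Euler's
  identity in the coordinates dual to the \<open>u\<^sub>i\<close> writes \<open>f\<close> as a sum of \<open>d\<close>-th powers of these
  coordinates. Conversely, the center of such a sum consists of the matrices that are diagonal in
  the basis \<open>u\<^sub>i\<close>.

  The idempotents come for free in (2), and in (6) because commuting matrices of rank and trace 1
  are equal or have product 0. Under (3), (4) or (5), \<open>Z(f)\<close> has no nonzero \<open>X\<close> with \<open>X\<^sup>2 = 0\<close> (for
  (3), every \<open>X v\<close> would be a singular point); then a maximal family of orthogonal idempotents
  spans \<open>Z(f)\<close>, so it has \<open>dim Z(f) = n\<close> members.
\<close>

section \<open>Polynomials, evaluation and formal derivatives\<close>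

lemma poly_mapping_sum_monomials:
  "(\<Sum>m\<in>Poly_Mapping.keys f. Poly_Mapping.single m (Poly_Mapping.lookup f m)) = f"
  by (rule poly_mapping_eqI)
    (auto simp: lookup_sum lookup_single when_def sum.If_cases in_keys_iff not_in_keys_iff_lookup_eq_zero)

lemma const_poly_add: "const_poly (a + b) = const_poly a + const_poly b"
  by (simp add: const_poly_def single_add)

lemma const_poly_mult: "const_poly (a * b) = const_poly a * const_poly b"
  by (simp add: const_poly_def mult_single)

lemma const_poly_0 [simp]: "const_poly 0 = 0"
  by (simp add: const_poly_def)

lemma const_poly_1 [simp]: "const_poly 1 = 1"
  by (simp add: const_poly_def)

lemma const_poly_sum: "const_poly (sum g A) = (\<Sum>a\<in>A. const_poly (g a))"
  by (induction A rule: infinite_finite_induct) (simp_all add: const_poly_add)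

lemma const_poly_of_nat: "const_poly (of_nat k) = of_nat k"
  by (induction k) (simp_all add: const_poly_add)

lemma lookup_const_poly_mult:
  "Poly_Mapping.lookup (const_poly c * p) m = c * Poly_Mapping.lookup p m"
  by (simp add: const_poly_def mult_map_scale_conv_mult [symmetric] Poly_Mapping.map.rep_eq when_def)

lemma const_poly_mult_eq_0_iff: "const_poly c * p = 0 \<longleftrightarrow> c = 0 \<or> p = 0"
  by (auto simp: poly_mapping_eq_iff fun_eq_iff lookup_const_poly_mult)

lemma var_poly_power: "var_poly i ^ k = Poly_Mapping.single (Poly_Mapping.single i k) 1"
  by (induction k) (simp_all add: var_poly_def mult_single single_add [symmetric])

lemma monomial_eq_prod:
  fixes m :: "'n::finite \<Rightarrow>\<^sub>0 nat"
  shows "Poly_Mapping.single m c =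
    const_poly c * (\<Prod>i\<in>UNIV. var_poly i ^ Poly_Mapping.lookup m i)"
proof -
  have "(\<Prod>i\<in>A. Poly_Mapping.single (g i) (1::complex)) = Poly_Mapping.single (sum g A) 1"
    if "finite A" for A :: "'n set" and g :: "'n \<Rightarrow> ('n \<Rightarrow>\<^sub>0 nat)"
    using that by (induction A) (simp_all add: mult_single)
  moreover have "(\<Sum>i\<in>UNIV. Poly_Mapping.single i (Poly_Mapping.lookup m i)) = m"
    by (rule poly_mapping_eqI) (simp add: lookup_sum lookup_single when_def)
  ultimately show ?thesis
    by (simp add: var_poly_power const_poly_def mult_single)
qed

text \<open>Every polynomial is a finite sum of monomials, and each monomial is a constant times a
  product of powers of variables. The rule serves to prove the chain rule for linear
  substitutions.\<close>

lemma cpoly_induct [case_names const var add mult]: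
  fixes f :: "'n::finite cpoly"
  assumes const: "\<And>c. P (const_poly c)"
    and var: "\<And>i. P (var_poly i)"
    and add: "\<And>f g. P f \<Longrightarrow> P g \<Longrightarrow> P (f + g)"
    and mult: "\<And>f g. P f \<Longrightarrow> P g \<Longrightarrow> P (f * g)"
  shows "P f"
proof -
  have power: "P (g ^ k)" if "P g" for g k
    using that const [of 1] by (induction k) (simp_all add: mult)
  have prod: "P (prod g A)" if "\<And>i. P (g i)" for g and A :: "'n set"
    using that const [of 1] by (induction A rule: infinite_finite_induct) (simp_all add: mult)
  have sum: "P (sum g A)" if "\<And>i. P (g i)" for g and A :: "('n \<Rightarrow>\<^sub>0 nat) set"
    using that const [of 0] by (induction A rule: infinite_finite_induct) (simp_all add: add)
  have "P (\<Sum>m\<in>Poly_Mapping.keys f. Poly_Mapping.single m (Poly_Mapping.lookup f m))"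
    by (intro sum) (simp add: monomial_eq_prod mult const prod power var)
  then show ?thesis by (simp add: poly_mapping_sum_monomials)
qed

text \<open>The common generalization of \<^const>\<open>eval_poly\<close> and \<^const>\<open>subst_poly\<close>.\<close>

locale substitution =
  fixes h :: "complex \<Rightarrow> 'r::comm_ring_1" and g :: "'n::finite \<Rightarrow> 'r"
  assumes h_add: "h (a + b) = h a + h b"
    and h_mult: "h (a * b) = h a * h b"
    and h_1: "h 1 = 1"
begin

lemma h_0: "h 0 = 0"
  using h_add [of 0 0] by simp

definition subst where
  "subst f = (\<Sum>m\<in>Poly_Mapping.keys f.
     h (Poly_Mapping.lookup f m) * (\<Prod>i\<in>UNIV. g i ^ Poly_Mapping.lookup m i))"

text \<open>Cancellation can make the keys of a sum smaller than the union of the keys of its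
  summands. Enlarging the index set by terms with coefficient \<open>0\<close> lets several
  polynomials share one index set.\<close>

lemma subst_superset:
  assumes "finite A" "Poly_Mapping.keys f \<subseteq> A"
  shows "subst f = (\<Sum>m\<in>A. h (Poly_Mapping.lookup f m) * (\<Prod>i\<in>UNIV. g i ^ Poly_Mapping.lookup m i))"
  unfolding subst_def using assms by (intro sum.mono_neutral_left) (auto simp: in_keys_iff h_0)

lemma subst_single:
  "subst (Poly_Mapping.single m c) = h c * (\<Prod>i\<in>UNIV. g i ^ Poly_Mapping.lookup m i)"
  by (subst subst_superset [of "{m}"]) auto

lemma subst_add: "subst (p + q) = subst p + subst q"
proof -
  define A where "A = Poly_Mapping.keys p \<union> Poly_Mapping.keys q"
  have "finite A" "Poly_Mapping.keys p \<subseteq> A" "Poly_Mapping.keys q \<subseteq> A"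
    "Poly_Mapping.keys (p + q) \<subseteq> A"
    by (auto simp: A_def in_keys_iff lookup_add)
  then show ?thesis
    by (simp add: subst_superset [of A] lookup_add h_add sum.distrib distrib_right)
qed

lemma subst_0: "subst 0 = 0"
  by (simp add: subst_def)

lemma subst_sum: "subst (sum p A) = (\<Sum>a\<in>A. subst (p a))"
  by (induction A rule: infinite_finite_induct) (simp_all add: subst_add subst_0)

text \<open>For two monomials this is additivity of exponents; both sides are biadditive, so
  decomposing \<open>p\<close> and \<open>q\<close> into monomials suffices.\<close>

lemma subst_mult: "subst (p * q) = subst p * subst q"
proof -
  have single: "subst (Poly_Mapping.single m c * Poly_Mapping.single m' c') =
      subst (Poly_Mapping.single m c) * subst (Poly_Mapping.single m' c')" for m c m' c'
    by (simp add: mult_single subst_single lookup_add power_add prod.distrib h_mult)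
  have "subst (p * q) =
      subst ((\<Sum>m\<in>Poly_Mapping.keys p. Poly_Mapping.single m (Poly_Mapping.lookup p m)) *
             (\<Sum>m\<in>Poly_Mapping.keys q. Poly_Mapping.single m (Poly_Mapping.lookup q m)))"
    by (simp add: poly_mapping_sum_monomials)
  also have "\<dots> =
      subst (\<Sum>m\<in>Poly_Mapping.keys p. Poly_Mapping.single m (Poly_Mapping.lookup p m)) *
      subst (\<Sum>m\<in>Poly_Mapping.keys q. Poly_Mapping.single m (Poly_Mapping.lookup q m))"
    by (simp add: sum_product subst_sum single)
  finally show ?thesis by (simp add: poly_mapping_sum_monomials)
qed

lemma subst_const: "subst (const_poly c) = h c"
  by (simp add: const_poly_def subst_single)

lemma subst_var: "subst (var_poly i) = g i"
proof -
  have "(\<Prod>j\<in>UNIV. g j ^ Poly_Mapping.lookup (Poly_Mapping.single i 1) j) =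
      (\<Prod>j\<in>UNIV. if j = i then g i else 1)"
    by (intro prod.cong) (auto simp: lookup_single when_def)
  then show ?thesis by (simp add: var_poly_def subst_single h_1)
qed

end

lemma substitution_id: "substitution (\<lambda>c. c)"
  by unfold_locales simp_all

lemma substitution_const_poly: "substitution const_poly"
  by unfold_locales (simp_all add: const_poly_add const_poly_mult)

lemma eval_poly_eq: "eval_poly f v = substitution.subst (\<lambda>c. c) (($) v) f"
  by (simp add: eval_poly_def substitution.subst_def [OF substitution_id])

lemma subst_poly_eq: "subst_poly g f = substitution.subst const_poly g f"
  by (simp add: subst_poly_def substitution.subst_def [OF substitution_const_poly])

lemma eval_poly_add: "eval_poly (p + q) v = eval_poly p v + eval_poly q v"
  by (simp add: eval_poly_eq substitution.subst_add [OF substitution_id])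

lemma eval_poly_mult: "eval_poly (p * q) v = eval_poly p v * eval_poly q v"
  by (simp add: eval_poly_eq substitution.subst_mult [OF substitution_id])

lemma eval_poly_const [simp]: "eval_poly (const_poly c) v = c"
  by (simp add: eval_poly_eq substitution.subst_const [OF substitution_id])

lemma eval_poly_var [simp]: "eval_poly (var_poly i) v = v $ i"
  by (simp add: eval_poly_eq substitution.subst_var [OF substitution_id])

lemma eval_poly_0 [simp]: "eval_poly 0 v = 0"
  using eval_poly_const [of 0 v] by simp

lemma eval_poly_1 [simp]: "eval_poly 1 v = 1"
  using eval_poly_const [of 1 v] by simp

lemma eval_poly_sum: "eval_poly (sum p A) v = (\<Sum>a\<in>A. eval_poly (p a) v)"
  by (induction A rule: infinite_finite_induct) (simp_all add: eval_poly_add)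

lemma eval_poly_power: "eval_poly (p ^ k) v = eval_poly p v ^ k"
  by (induction k) (simp_all add: eval_poly_mult)

section \<open>Formal partial derivatives\<close>

text \<open>Only the monomial with exponent vector \<open>m + Poly_Mapping.single i 1\<close>
  contributes to the coefficient at \<open>m\<close>. In this form the truncated subtraction of the
  definition disappears.\<close>

lemma lookup_partial_deriv:
  fixes f :: "'n cpoly"
  shows "Poly_Mapping.lookup (partial_deriv i f) m =
    of_nat (Suc (Poly_Mapping.lookup m i)) * Poly_Mapping.lookup f (m + Poly_Mapping.single i 1)"
proof -
  let ?s = "Poly_Mapping.single i (1::nat)"
  \<comment> \<open>Truncated subtraction can be undone only if the variable occurs; the monomials
    in which it does not occur carry the factor \<open>0\<close>.\<close>
  have *: "k - ?s = m \<longleftrightarrow> k = m + ?s" if "Poly_Mapping.lookup k i \<noteq> 0" for k :: "'n \<Rightarrow>\<^sub>0 nat"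
    using that by (auto simp: poly_mapping_eq_iff fun_eq_iff lookup_minus lookup_add lookup_single when_def
      split: if_splits)
  have "Poly_Mapping.lookup (partial_deriv i f) m =
      (\<Sum>k\<in>Poly_Mapping.keys f. if k = m + ?s
         then of_nat (Suc (Poly_Mapping.lookup m i)) * Poly_Mapping.lookup f (m + ?s) else 0)"
    unfolding partial_deriv_def lookup_sum
  proof (intro sum.cong refl)
    fix k
    show "Poly_Mapping.lookup (Poly_Mapping.single (k - ?s)
         (of_nat (Poly_Mapping.lookup k i) * Poly_Mapping.lookup f k)) m =
        (if k = m + ?s then of_nat (Suc (Poly_Mapping.lookup m i)) * Poly_Mapping.lookup f (m + ?s) else 0)"
      using * [of k]
      by (cases "Poly_Mapping.lookup k i = 0") (auto simp: lookup_single when_def lookup_add)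
  qed
  also have "\<dots> = of_nat (Suc (Poly_Mapping.lookup m i)) * Poly_Mapping.lookup f (m + ?s)"
    by (simp add: not_in_keys_iff_lookup_eq_zero)
  finally show ?thesis .
qed

lemma partial_deriv_add: "partial_deriv i (f + g) = partial_deriv i f + partial_deriv i g"
  by (rule poly_mapping_eqI) (simp add: lookup_partial_deriv lookup_add distrib_left)

lemma partial_deriv_commute:
  "partial_deriv i (partial_deriv j f) = partial_deriv j (partial_deriv i f)"
proof (cases "i = j")
  case False
  then show ?thesis
    by (intro poly_mapping_eqI) (simp add: lookup_partial_deriv lookup_add lookup_single add.commute add.left_commute)
qed simp

lemma partial_deriv_0 [simp]: "partial_deriv i 0 = 0"
  by (simp add: partial_deriv_def)

lemma partial_deriv_sum: "partial_deriv i (sum g A) = (\<Sum>a\<in>A. partial_deriv i (g a))"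
  by (induction A rule: infinite_finite_induct) (simp_all add: partial_deriv_add)

lemma partial_deriv_single:
  "partial_deriv i (Poly_Mapping.single m c) =
    Poly_Mapping.single (m - Poly_Mapping.single i 1) (of_nat (Poly_Mapping.lookup m i) * c)"
  by (cases "c = 0") (simp_all add: partial_deriv_def)

lemma partial_deriv_const [simp]: "partial_deriv i (const_poly c) = 0"
  by (simp add: const_poly_def partial_deriv_single)

lemma partial_deriv_var: "partial_deriv i (var_poly j) = (if i = j then 1 else 0)"
  by (simp add: var_poly_def partial_deriv_single lookup_single)

text \<open>The Leibniz rule is checked on pairs of monomials and extended biadditively.\<close>

lemma partial_deriv_mult:
  fixes f g :: "'n cpoly"
  shows "partial_deriv i (f * g) = partial_deriv i f * g + f * partial_deriv i g"
proof -
  let ?s = "Poly_Mapping.single i (1::nat)"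
  have shift: "k + l - ?s = k - ?s + l" if "Poly_Mapping.lookup k i \<noteq> 0" for k l :: "'n \<Rightarrow>\<^sub>0 nat"
    using that by (auto simp: poly_mapping_eq_iff fun_eq_iff lookup_minus lookup_add lookup_single when_def)
  have single: "partial_deriv i (Poly_Mapping.single k a * Poly_Mapping.single l b) =
      partial_deriv i (Poly_Mapping.single k a) * Poly_Mapping.single l b +
      Poly_Mapping.single k a * partial_deriv i (Poly_Mapping.single l b)" for k l a b
    using shift [of k l] shift [of l k]
    by (cases "Poly_Mapping.lookup k i = 0"; cases "Poly_Mapping.lookup l i = 0")
      (simp_all add: mult_single partial_deriv_single lookup_add algebra_simps single_add [symmetric])
  let ?F = "\<Sum>m\<in>Poly_Mapping.keys f. Poly_Mapping.single m (Poly_Mapping.lookup f m)"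
  let ?G = "\<Sum>m\<in>Poly_Mapping.keys g. Poly_Mapping.single m (Poly_Mapping.lookup g m)"
  have "partial_deriv i (?F * ?G) = partial_deriv i ?F * ?G + ?F * partial_deriv i ?G"
    unfolding sum_product partial_deriv_sum single sum.distrib ..
  then show ?thesis by (simp add: poly_mapping_sum_monomials)
qed

section \<open>Homogeneous polynomials, Euler's identity and the chain rule\<close>

lemma homogeneous_iff:
  "homogeneous d f \<longleftrightarrow>
    (\<forall>m. Poly_Mapping.lookup f m \<noteq> 0 \<longrightarrow> (\<Sum>i\<in>UNIV. Poly_Mapping.lookup m i) = d)"
  by (auto simp: homogeneous_def in_keys_iff)

lemma homogeneous_partial_deriv:
  assumes "homogeneous (Suc d) f"
  shows "homogeneous d (partial_deriv i f)"
  unfolding homogeneous_iff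
proof (intro allI impI)
  fix m
  assume "Poly_Mapping.lookup (partial_deriv i f) m \<noteq> 0"
  then have "Poly_Mapping.lookup f (m + Poly_Mapping.single i 1) \<noteq> 0"
    by (simp add: lookup_partial_deriv)
  then have "(\<Sum>j\<in>UNIV. Poly_Mapping.lookup (m + Poly_Mapping.single i 1) j) = Suc d"
    using assms unfolding homogeneous_iff by blast
  then show "(\<Sum>j\<in>UNIV. Poly_Mapping.lookup m j) = d"
    by (simp add: lookup_add sum.distrib lookup_single when_def)
qed

lemma homogeneous_add: "homogeneous d f \<Longrightarrow> homogeneous d g \<Longrightarrow> homogeneous d (f + g)"
  unfolding homogeneous_iff lookup_add by (metis add_0)

lemma homogeneous_const_mult: "homogeneous d f \<Longrightarrow> homogeneous d (const_poly c * f)"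
  by (simp add: homogeneous_iff lookup_const_poly_mult)

lemma homogeneous_sum: "(\<And>a. a \<in> A \<Longrightarrow> homogeneous d (g a)) \<Longrightarrow> homogeneous d (sum g A)"
  by (induction A rule: infinite_finite_induct) (simp_all add: homogeneous_add, simp_all add: homogeneous_iff)

lemma homogeneous_0_imp_const:
  assumes "homogeneous 0 f"
  obtains c where "f = const_poly c"
proof
  show "f = const_poly (Poly_Mapping.lookup f 0)"
  proof (rule poly_mapping_eqI)
    fix m
    have "m = 0" if "Poly_Mapping.lookup f m \<noteq> 0"
    proof (rule poly_mapping_eqI)
      fix i
      show "Poly_Mapping.lookup m i = Poly_Mapping.lookup 0 i"
        using assms that by (auto simp: homogeneous_iff)
    qed
    then show "Poly_Mapping.lookup f m = Poly_Mapping.lookup (const_poly (Poly_Mapping.lookup f 0)) m"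
      by (auto simp: const_poly_def lookup_single when_def)
  qed
qed

lemma of_nat_mult_single:
  "of_nat k * Poly_Mapping.single m c = (Poly_Mapping.single m (of_nat k * c) :: 'n cpoly)"
  by (metis add_0 mult_single single_of_nat)

text \<open>Applying \<open>partial_deriv i\<close> and multiplying by the variable scales a
  monomial by its exponent at \<open>i\<close>; these exponents add up to the degree
  \<open>d\<close>.\<close>

lemma Euler_identity:
  fixes f :: "'n::finite cpoly"
  assumes "homogeneous d f"
  shows "(\<Sum>i\<in>UNIV. var_poly i * partial_deriv i f) = of_nat d * f"
proof -
  let ?t = "\<lambda>m. Poly_Mapping.single m (Poly_Mapping.lookup f m)"
  have shift: "Poly_Mapping.single i 1 + (m - Poly_Mapping.single i 1) = m"
    if "Poly_Mapping.lookup m i \<noteq> 0" for m :: "'n \<Rightarrow>\<^sub>0 nat" and i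
    using that by (auto simp: poly_mapping_eq_iff fun_eq_iff lookup_minus lookup_add lookup_single when_def)
  have single: "var_poly i * partial_deriv i (Poly_Mapping.single m c) =
      of_nat (Poly_Mapping.lookup m i) * Poly_Mapping.single m c" for m :: "'n \<Rightarrow>\<^sub>0 nat" and i c
    using shift [of m i]
    by (cases "Poly_Mapping.lookup m i = 0")
      (simp_all add: var_poly_def partial_deriv_single mult_single of_nat_mult_single)
  have "(\<Sum>i\<in>UNIV. var_poly i * partial_deriv i (\<Sum>m\<in>Poly_Mapping.keys f. ?t m)) =
      (\<Sum>i\<in>UNIV. \<Sum>m\<in>Poly_Mapping.keys f. of_nat (Poly_Mapping.lookup m i) * ?t m)"
    by (simp add: partial_deriv_sum sum_distrib_left single)
  also have "\<dots> = (\<Sum>m\<in>Poly_Mapping.keys f. of_nat (\<Sum>i\<in>UNIV. Poly_Mapping.lookup m i) * ?t m)"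
    by (subst sum.swap) (simp add: sum_distrib_right)
  also have "\<dots> = (\<Sum>m\<in>Poly_Mapping.keys f. of_nat d * ?t m)"
    using assms by (intro sum.cong) (auto simp: homogeneous_def)
  finally show ?thesis by (simp add: poly_mapping_sum_monomials sum_distrib_left [symmetric])
qed

text \<open>The chain rule for \<open>x = P y\<close>: differentiating in the new variable
  \<open>j\<close> amounts to differentiating \<open>f\<close> along column \<open>j\<close> of
  \<open>P\<close>.\<close>

lemma partial_deriv_linear_subst:
  fixes P :: "complex^'n^'n::finite"
  shows "partial_deriv j (linear_subst P f) =
    (\<Sum>i\<in>UNIV. const_poly (P $ i $ j) * linear_subst P (partial_deriv i f))"
proof (induction f rule: cpoly_induct)
  case (const c)
  then show ?case
    by (simp add: linear_subst_def subst_poly_eq substitution.subst_const [OF substitution_const_poly]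
      substitution.subst_0 [OF substitution_const_poly])
next
  case (var i)
  have [simp]: "subst_poly g 0 = 0" "subst_poly g 1 = 1" for g :: "'n \<Rightarrow> 'n cpoly"
    using substitution.subst_const [OF substitution_const_poly, of g 0]
      substitution.subst_const [OF substitution_const_poly, of g 1]
    by (simp_all add: subst_poly_eq)
  have "partial_deriv j (linear_subst P (var_poly i)) = const_poly (P $ i $ j)"
    by (simp add: linear_subst_def subst_poly_eq substitution.subst_var [OF substitution_const_poly]
      partial_deriv_sum partial_deriv_mult partial_deriv_var if_distrib [of "(*) _"] cong: if_cong)
  moreover have "linear_subst P (partial_deriv k (var_poly i)) = (if k = i then 1 else 0)" for k
    by (simp add: partial_deriv_var linear_subst_def)
  ultimately show ?case
    by (simp add: if_distrib [of "(*) _"] cong: if_cong)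
next
  case (add f g)
  then show ?case
    by (simp add: linear_subst_def subst_poly_eq substitution.subst_add [OF substitution_const_poly]
      partial_deriv_add sum.distrib distrib_left)
next
  case (mult f g)
  have [simp]: "linear_subst P (p * q) = linear_subst P p * linear_subst P q"
    "linear_subst P (p + q) = linear_subst P p + linear_subst P q" for p q
    by (simp_all add: linear_subst_def subst_poly_eq substitution.subst_mult [OF substitution_const_poly]
      substitution.subst_add [OF substitution_const_poly])
  show ?case
    by (simp add: partial_deriv_mult mult.IH sum_distrib_left sum_distrib_right sum.distrib algebra_simps)
qed

section \<open>Directional derivatives and the center\<close>

text \<open>Derivatives along arbitrary vectors, not only along the axes, allow the symmetry of the
  Hessian times \<open>X\<close> to be stated without coordinates.\<close>

definition dir_deriv :: "complex^'n \<Rightarrow> 'n::finite cpoly \<Rightarrow> 'n cpoly" where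
  "dir_deriv w f = (\<Sum>i\<in>UNIV. const_poly (w $ i) * partial_deriv i f)"

definition lin_form :: "complex^'n \<Rightarrow> 'n::finite cpoly" where
  "lin_form w = (\<Sum>i\<in>UNIV. const_poly (w $ i) * var_poly i)"

lemma dir_deriv_0_left [simp]: "dir_deriv 0 f = 0"
  by (simp add: dir_deriv_def)

lemma dir_deriv_0_right [simp]: "dir_deriv w 0 = 0"
  by (simp add: dir_deriv_def)

lemma dir_deriv_add_left: "dir_deriv (v + w) f = dir_deriv v f + dir_deriv w f"
  by (simp add: dir_deriv_def const_poly_add distrib_right sum.distrib)

lemma dir_deriv_diff_left: "dir_deriv (v - w) f = dir_deriv v f - dir_deriv w f"
  using dir_deriv_add_left [of "v - w" w f] by (simp add: algebra_simps)

lemma dir_deriv_scale_left: "dir_deriv (c *s w) f = const_poly c * dir_deriv w f"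
  by (simp add: dir_deriv_def const_poly_mult sum_distrib_left mult.assoc)

lemma dir_deriv_sum_left: "dir_deriv (sum w A) f = (\<Sum>a\<in>A. dir_deriv (w a) f)"
  by (induction A rule: infinite_finite_induct) (simp_all add: dir_deriv_add_left)

lemma dir_deriv_add_right: "dir_deriv w (f + g) = dir_deriv w f + dir_deriv w g"
  by (simp add: dir_deriv_def partial_deriv_add distrib_left sum.distrib)

lemma dir_deriv_sum_right: "dir_deriv w (sum g A) = (\<Sum>a\<in>A. dir_deriv w (g a))"
  by (induction A rule: infinite_finite_induct) (simp_all add: dir_deriv_add_right)

lemma dir_deriv_mult: "dir_deriv w (f * g) = dir_deriv w f * g + f * dir_deriv w g"
  by (simp add: dir_deriv_def partial_deriv_mult distrib_left sum.distrib sum_distrib_left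
    sum_distrib_right ac_simps)

lemma dir_deriv_const [simp]: "dir_deriv w (const_poly c) = 0"
  by (simp add: dir_deriv_def)

lemma dir_deriv_const_mult: "dir_deriv w (const_poly c * f) = const_poly c * dir_deriv w f"
  by (simp add: dir_deriv_mult)

lemma dir_deriv_power: "dir_deriv w (f ^ Suc k) = of_nat (Suc k) * f ^ k * dir_deriv w f"
  by (induction k) (simp_all add: dir_deriv_mult algebra_simps)

lemma dir_deriv_axis: "dir_deriv (axis i 1) f = partial_deriv i f"
  by (simp add: dir_deriv_def axis_def if_distrib [of const_poly] if_distrib [of "\<lambda>x. x * _"] cong: if_cong)

lemma dir_deriv_commute: "dir_deriv v (dir_deriv w f) = dir_deriv w (dir_deriv v f)"
proof -
  have *: "dir_deriv v (dir_deriv w f) =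
      (\<Sum>i\<in>UNIV. \<Sum>j\<in>UNIV. const_poly (v $ i) * (const_poly (w $ j) * partial_deriv i (partial_deriv j f)))"
    for v w
    unfolding dir_deriv_def [of v] unfolding dir_deriv_def [of w]
    by (simp add: partial_deriv_sum partial_deriv_mult sum_distrib_left)
  show ?thesis
    unfolding * by (subst sum.swap) (simp add: partial_deriv_commute [of _ _ f] mult.left_commute)
qed

lemma homogeneous_dir_deriv: "homogeneous (Suc d) f \<Longrightarrow> homogeneous d (dir_deriv w f)"
  unfolding dir_deriv_def
  by (intro homogeneous_sum homogeneous_const_mult homogeneous_partial_deriv)

lemma dir_deriv_lin_form: "dir_deriv w (lin_form v) = const_poly (\<Sum>i\<in>UNIV. v $ i * w $ i)"
proof -
  have "dir_deriv w (var_poly i) = const_poly (w $ i)" for i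
    by (simp add: dir_deriv_def partial_deriv_var if_distrib [of "(*) _"] cong: if_cong)
  then show ?thesis
    by (simp add: lin_form_def dir_deriv_sum_right dir_deriv_const_mult const_poly_sum const_poly_mult)
qed

lemma eval_lin_form [simp]: "eval_poly (lin_form v) w = (\<Sum>i\<in>UNIV. v $ i * w $ i)"
  by (simp add: lin_form_def eval_poly_sum eval_poly_mult)

lemma homogeneous_lin_form: "homogeneous 1 (lin_form v)"
  unfolding lin_form_def
  by (intro homogeneous_sum homogeneous_const_mult)
    (auto simp: homogeneous_def var_poly_def lookup_single when_def)

text \<open>The partial derivatives of a form of degree 1 are constants, and Euler's identity
  reassembles the form from them.\<close>

lemma homogeneous_1_imp_lin_form:
  fixes l :: "'n::finite cpoly"
  assumes "homogeneous 1 l"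
  obtains v where "l = lin_form v"
proof -
  have "\<exists>c. partial_deriv i l = const_poly c" for i
  proof -
    have "homogeneous 0 (partial_deriv i l)"
      using assms by (simp add: homogeneous_partial_deriv)
    then show ?thesis by (metis homogeneous_0_imp_const)
  qed
  then obtain c where c: "\<And>i. partial_deriv i l = const_poly (c i)" by metis
  have "l = lin_form (\<chi> i. c i)"
    using Euler_identity [OF assms] by (simp add: lin_form_def c mult.commute)
  then show ?thesis by (rule that)
qed

lemma Euler_identity_eval:
  assumes "homogeneous d f"
  shows "eval_poly (dir_deriv v f) v = of_nat d * eval_poly f v"
proof -
  have "eval_poly (dir_deriv v f) v = eval_poly (\<Sum>i\<in>UNIV. var_poly i * partial_deriv i f) v"
    by (simp add: dir_deriv_def eval_poly_sum eval_poly_mult)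
  then show ?thesis
    by (simp add: Euler_identity [OF assms] eval_poly_mult const_poly_of_nat [symmetric])
qed

lemma matrix_mul_entry: "(A ** B) $ i $ j = (\<Sum>k\<in>UNIV. A $ i $ k * B $ k $ j)"
  by (simp add: matrix_matrix_mult_def)

text \<open>Euler's identity does not depend on the basis: the columns of \<open>P\<close> form a
  basis and the rows of \<open>Q\<close> are the dual coordinates, so the double sum collapses by
  \<open>P ** Q = mat 1\<close>.\<close>

lemma Euler_identity_frame:
  fixes P Q :: "complex^'n^'n::finite"
  assumes "P ** Q = mat 1" "homogeneous d f"
  shows "of_nat d * f = (\<Sum>i\<in>UNIV. lin_form (Q $ i) * dir_deriv (column i P) f)"
proof -
  have "(\<Sum>i\<in>UNIV. lin_form (Q $ i) * dir_deriv (column i P) f) =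
      (\<Sum>i\<in>UNIV. \<Sum>b\<in>UNIV. \<Sum>a\<in>UNIV.
         const_poly (P $ a $ i * Q $ i $ b) * (var_poly b * partial_deriv a f))"
    by (simp add: lin_form_def dir_deriv_def sum_product column_def const_poly_mult ac_simps)
  also have "\<dots> = (\<Sum>b\<in>UNIV. \<Sum>a\<in>UNIV. \<Sum>i\<in>UNIV.
         const_poly (P $ a $ i * Q $ i $ b) * (var_poly b * partial_deriv a f))"
    by (subst sum.swap) (intro sum.cong refl sum.swap)
  also have "\<dots> = (\<Sum>b\<in>UNIV. \<Sum>a\<in>UNIV.
         const_poly ((P ** Q) $ a $ b) * (var_poly b * partial_deriv a f))"
    by (simp add: matrix_mul_entry const_poly_sum sum_distrib_right)
  also have "\<dots> = (\<Sum>b\<in>UNIV. \<Sum>a\<in>UNIV. if a = b then var_poly b * partial_deriv b f else 0)"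
    by (intro sum.cong refl) (auto simp: assms mat_def)
  also have "\<dots> = of_nat d * f"
    by (simp add: Euler_identity [OF assms(2)])
  finally show ?thesis ..
qed

lemma exists_invertible_with_column:
  fixes w :: "'a::field^'n::finite"
  assumes "w \<noteq> 0"
  obtains P :: "'a^'n^'n" and k where "invertible P" "column k P = w"
proof -
  obtain k where k: "w $ k \<noteq> 0"
    using assms by (auto simp: vec_eq_iff)
  \<comment> \<open>The identity matrix with column \<open>k\<close> replaced by \<open>w\<close>,
    at a position where \<open>w\<close> has a nonzero entry.\<close>
  define P :: "'a^'n^'n" where "P = (\<chi> i j. if j = k then w $ i else if i = j then 1 else 0)"
  have "y = 0" if "P *v y = 0" for y
  proof -
    have row: "(P *v y) $ i = w $ i * y $ k + (if i = k then 0 else y $ i)" for i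
    proof -
      have "(P *v y) $ i = (\<Sum>j\<in>UNIV. (if j = k then w $ i * y $ k else 0) +
          (if j = i then (if i = k then 0 else y $ i) else 0))"
        unfolding matrix_vector_mult_def P_def vec_lambda_beta by (rule sum.cong) auto
      then show ?thesis by (simp add: sum.distrib)
    qed
    have "y $ k = 0"
      using row [of k] that k by simp
    then show ?thesis
      using row that by (simp add: vec_eq_iff) metis
  qed
  then have "invertible P"
    by (metis invertible_left_inverse matrix_left_invertible_ker)
  moreover have "column k P = w"
    by (simp add: column_def P_def vec_eq_iff)
  ultimately show ?thesis by (rule that)
qed

text \<open>A nonzero \<open>w\<close> could be made the \<open>k\<close>-th vector of a new basis.
  In these coordinates the derivative in variable \<open>k\<close> vanishes, and in characteristic 0
  this means that the variable does not occur.\<close>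

lemma nondegenerate_dir_deriv:
  fixes f :: "'n::finite cpoly"
  assumes "nondegenerate f" "dir_deriv w f = 0"
  shows "w = 0"
proof (rule ccontr)
  assume "w \<noteq> 0"
  then obtain P :: "complex^'n^'n" and k where P: "invertible P" "column k P = w"
    by (rule exists_invertible_with_column)
  have linear_subst: "linear_subst P (\<Sum>i\<in>UNIV. const_poly (c i) * p i) =
      (\<Sum>i\<in>UNIV. const_poly (c i) * linear_subst P (p i))" for c p
    by (simp add: linear_subst_def subst_poly_eq substitution.subst_sum [OF substitution_const_poly]
      substitution.subst_mult [OF substitution_const_poly] substitution.subst_const [OF substitution_const_poly])
  have "linear_subst P (dir_deriv w f) = 0"
    by (simp add: assms linear_subst_def subst_poly_def)
  then have deriv: "partial_deriv k (linear_subst P f) = 0"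
    using P by (auto simp: partial_deriv_linear_subst dir_deriv_def linear_subst column_def)
  have "k \<notin> occurring_vars (linear_subst P f)"
  proof
    assume "k \<in> occurring_vars (linear_subst P f)"
    then obtain m where m: "Poly_Mapping.lookup (linear_subst P f) m \<noteq> 0" "Poly_Mapping.lookup m k \<noteq> 0"
      by (auto simp: occurring_vars_def in_keys_iff)
    \<comment> \<open>The exponent at \<open>k\<close> is positive, so the subtraction is not
      truncated and the coefficient at \<open>m\<close> reappears, with a nonzero factor, in the
      derivative.\<close>
    have "m - Poly_Mapping.single k 1 + Poly_Mapping.single k 1 = m"
      using m(2) by (auto simp: poly_mapping_eq_iff fun_eq_iff lookup_minus lookup_add lookup_single when_def)
    then have "Poly_Mapping.lookup (partial_deriv k (linear_subst P f)) (m - Poly_Mapping.single k 1) \<noteq> 0"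
      using m(1) by (simp add: lookup_partial_deriv del: of_nat_Suc)
    then show False by (simp add: deriv)
  qed
  then have "card (occurring_vars (linear_subst P f)) < CARD('n)"
    by (intro psubset_card_mono) auto
  then show False
    using assms(1) P(1) by (auto simp: nondegenerate_def)
qed

text \<open>The entries of the Hessian times \<open>X\<close> are second derivatives along an axis
  and a column of \<open>X\<close>. Their symmetry is the stated identity for axis vectors, and both
  sides are bilinear in \<open>u\<close> and \<open>v\<close>.\<close>

lemma center_iff:
  fixes f :: "'n::finite cpoly"
  shows "X \<in> center f \<longleftrightarrow>
    (\<forall>u v. dir_deriv (X *v u) (dir_deriv v f) = dir_deriv u (dir_deriv (X *v v) f))"
proof
  have axis: "X *v axis j 1 = column j X" for j
    by (simp add: vec_eq_iff matrix_vector_mult_def column_def axis_def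
      if_distrib [of "(*) _"] cong: if_cong)
  have left: "dir_deriv (column j X) (partial_deriv i f) =
      (hessian f ** const_matrix X) $ i $ j" for i j
    by (simp add: dir_deriv_def column_def hessian_def const_matrix_def matrix_mul_entry
      mult.commute partial_deriv_commute [of i])
  have right: "partial_deriv j (dir_deriv (column i X) f) =
      (hessian f ** const_matrix X) $ j $ i" for i j
    by (simp add: dir_deriv_def column_def hessian_def const_matrix_def matrix_mul_entry
      partial_deriv_sum partial_deriv_mult mult.commute)
  have center: "X \<in> center f \<longleftrightarrow>
      (\<forall>i j. dir_deriv (column j X) (partial_deriv i f) = partial_deriv j (dir_deriv (column i X) f))"
    unfolding left right by (auto simp: center_def vec_eq_iff transpose_def)
  {
    assume "\<forall>u v. dir_deriv (X *v u) (dir_deriv v f) = dir_deriv u (dir_deriv (X *v v) f)"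
    then show "X \<in> center f"
      unfolding center by (metis axis dir_deriv_axis)
  next
    assume X: "X \<in> center f"
    have expand: "w = (\<Sum>i\<in>UNIV. w $ i *s axis i 1)" for w :: "complex^'n"
      by (simp add: basis_expansion)
    show "\<forall>u v. dir_deriv (X *v u) (dir_deriv v f) = dir_deriv u (dir_deriv (X *v v) f)"
    proof (intro allI)
      fix u v
      have Xw: "X *v w = (\<Sum>i\<in>UNIV. w $ i *s column i X)" for w
        by (simp add: matrix_mult_sum)
      have "dir_deriv (X *v u) (dir_deriv v f) =
          (\<Sum>j\<in>UNIV. \<Sum>i\<in>UNIV. const_poly (u $ j) * (const_poly (v $ i) *
             dir_deriv (column j X) (partial_deriv i f)))"
        unfolding Xw
        by (subst expand [of v], subst sum.swap)
          (simp add: dir_deriv_sum_left dir_deriv_scale_left dir_deriv_axis dir_deriv_sum_right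
            dir_deriv_const_mult sum_distrib_left mult.left_commute)
      also have "\<dots> = (\<Sum>j\<in>UNIV. \<Sum>i\<in>UNIV. const_poly (u $ j) * (const_poly (v $ i) *
             partial_deriv j (dir_deriv (column i X) f)))"
        using X by (simp add: center)
      also have "\<dots> = dir_deriv u (dir_deriv (X *v v) f)"
        unfolding Xw
        by (subst (2) expand [of u], subst sum.swap)
          (simp add: dir_deriv_sum_left dir_deriv_scale_left dir_deriv_axis dir_deriv_sum_right
            dir_deriv_const_mult sum_distrib_left partial_deriv_sum partial_deriv_mult mult.left_commute)
      finally show "dir_deriv (X *v u) (dir_deriv v f) = dir_deriv u (dir_deriv (X *v v) f)" .
    qed
  }
qed

lemma center_swap:
  "X \<in> center f \<Longrightarrow> dir_deriv (X *v u) (dir_deriv v f) = dir_deriv u (dir_deriv (X *v v) f)"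
  by (simp add: center_iff)

lemma center_mat_1: "mat 1 \<in> center f"
  by (simp add: center_iff)

lemma cmat_scale_mult_vec: "cmat_scale c X *v u = c *s (X *v u)"
  by (simp add: vec_eq_iff matrix_vector_mult_def cmat_scale_def sum_distrib_left mult.assoc)

lemma subspace_center: "cmat.subspace (center f)"
  unfolding cmat.subspace_def
  by (simp add: center_iff matrix_vector_mult_add_rdistrib dir_deriv_add_left dir_deriv_add_right
    cmat_scale_mult_vec dir_deriv_scale_left dir_deriv_const_mult)

section \<open>The center of a nondegenerate form is a commutative algebra\<close>

locale nondegenerate_form =
  fixes d :: nat and f :: "'n::finite cpoly"
  assumes degree: "d \<ge> 3" and homogeneous: "homogeneous d f" and nondegenerate: "nondegenerate f"
begin

text \<open>Since \<open>d\<close> is at least 3, the form \<open>dir_deriv w f\<close> and its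
  first derivatives have positive degree. Euler's identity then descends twice, from vanishing
  second derivatives to \<open>dir_deriv w f = 0\<close>, where nondegeneracy applies.\<close>

lemma eq_0_if_second_derivs_0:
  assumes "\<And>u v. dir_deriv u (dir_deriv v (dir_deriv w f)) = 0"
  shows "w = 0"
proof -
  obtain k where k: "d = Suc (Suc (Suc k))"
    using degree le_Suc_ex [of 3 d] by (auto simp: numeral_3_eq_3)
  have Euler: "p = 0" if "homogeneous (Suc j) p" "\<And>u. dir_deriv u p = 0" for p :: "'n cpoly" and j
  proof -
    have "of_nat (Suc j) * p = 0"
      using Euler_identity [OF that(1)] that(2) [of "axis _ 1"] by (simp add: dir_deriv_axis)
    then show ?thesis
      using const_poly_mult_eq_0_iff [of "of_nat (Suc j)" p]
      by (simp only: const_poly_of_nat of_nat_eq_0_iff) simp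
  qed
  have hom: "homogeneous (Suc (Suc k)) (dir_deriv w f)"
    using homogeneous by (simp add: k homogeneous_dir_deriv)
  have "dir_deriv v (dir_deriv w f) = 0" for v
    using Euler [OF homogeneous_dir_deriv [OF hom]] assms by blast
  then have "dir_deriv w f = 0"
    using Euler [OF hom] by blast
  then show ?thesis
    using nondegenerate nondegenerate_dir_deriv by blast
qed

text \<open>Directional derivatives commute, so \<open>w\<close> can be moved outside and the
  symmetry applied to the inner two. Thus \<open>X\<close> moves between any two of the three
  arguments.\<close>

lemma center_swap3:
  assumes "X \<in> center f"
  shows "dir_deriv (X *v u) (dir_deriv v (dir_deriv w f)) = dir_deriv u (dir_deriv (X *v v) (dir_deriv w f))"
proof -
  have "dir_deriv (X *v u) (dir_deriv v (dir_deriv w f)) = dir_deriv w (dir_deriv (X *v u) (dir_deriv v f))"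
    by (simp only: dir_deriv_commute [of v w] dir_deriv_commute [of "X *v u" w])
  also have "\<dots> = dir_deriv w (dir_deriv u (dir_deriv (X *v v) f))"
    by (simp only: center_swap [OF assms])
  also have "\<dots> = dir_deriv u (dir_deriv (X *v v) (dir_deriv w f))"
    by (simp only: dir_deriv_commute [of w u] dir_deriv_commute [of w "X *v v"])
  finally show ?thesis .
qed

text \<open>Let \<open>T\<close> be the symmetric trilinear map of third derivatives. Moving one
  matrix at a time gives \<open>T(X Y u, v, w) = T(Y u, v, X w) = T(u, Y v, X w) = T(X u, Y v, w) =
  T(Y X u, v, w)\<close>, so \<open>T\<close> vanishes as soon as one argument is a value of the
  commutator.\<close>

lemma center_commute:
  assumes "X \<in> center f" "Y \<in> center f"
  shows "X ** Y = Y ** X"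
proof -
  have "X *v (Y *v u) - Y *v (X *v u) = 0" for u
  proof (rule eq_0_if_second_derivs_0)
    fix v w
    have "dir_deriv (X *v (Y *v u)) (dir_deriv v (dir_deriv w f)) =
        dir_deriv (X *v (Y *v u)) (dir_deriv w (dir_deriv v f))"
      by (simp only: dir_deriv_commute [of v w])
    also have "\<dots> = dir_deriv (Y *v u) (dir_deriv (X *v w) (dir_deriv v f))"
      by (simp only: center_swap3 [OF assms(1)])
    also have "\<dots> = dir_deriv (Y *v u) (dir_deriv v (dir_deriv (X *v w) f))"
      by (simp only: dir_deriv_commute [of v "X *v w"])
    also have "\<dots> = dir_deriv u (dir_deriv (Y *v v) (dir_deriv (X *v w) f))"
      by (simp only: center_swap3 [OF assms(2)])
    also have "\<dots> = dir_deriv u (dir_deriv (X *v w) (dir_deriv (Y *v v) f))"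
      by (simp only: dir_deriv_commute [of "Y *v v" "X *v w"])
    also have "\<dots> = dir_deriv (X *v u) (dir_deriv w (dir_deriv (Y *v v) f))"
      by (simp only: center_swap3 [OF assms(1)])
    also have "\<dots> = dir_deriv (X *v u) (dir_deriv (Y *v v) (dir_deriv w f))"
      by (simp only: dir_deriv_commute [of w "Y *v v"])
    also have "\<dots> = dir_deriv (Y *v (X *v u)) (dir_deriv v (dir_deriv w f))"
      by (simp only: center_swap3 [OF assms(2)])
    finally have "dir_deriv (X *v (Y *v u) - Y *v (X *v u)) (dir_deriv v (dir_deriv w f)) = 0"
      by (simp add: dir_deriv_diff_left)
    then show "dir_deriv v (dir_deriv w (dir_deriv (X *v (Y *v u) - Y *v (X *v u)) f)) = 0"
      by (simp only: dir_deriv_commute [of w "X *v (Y *v u) - Y *v (X *v u)"]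
        dir_deriv_commute [of v "X *v (Y *v u) - Y *v (X *v u)"])
  qed
  then show ?thesis
    by (simp add: matrix_eq matrix_vector_mul_assoc)
qed

text \<open>Moving both factors across reverses their order; commutativity restores it.\<close>

lemma center_mult:
  assumes "X \<in> center f" "Y \<in> center f"
  shows "X ** Y \<in> center f"
  unfolding center_iff
proof (intro allI)
  fix u v
  have "dir_deriv (X *v (Y *v u)) (dir_deriv v f) = dir_deriv u (dir_deriv (Y *v (X *v v)) f)"
    by (simp add: center_swap assms)
  then show "dir_deriv ((X ** Y) *v u) (dir_deriv v f) = dir_deriv u (dir_deriv ((X ** Y) *v v) f)"
    by (metis matrix_vector_mul_assoc center_commute [OF assms])
qed

end

section \<open>Orthogonal idempotents in commutative matrix algebras\<close>

lemma cmat_scale_mult_left: "cmat_scale c A ** B = cmat_scale c (A ** B)"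
  by (simp add: vec_eq_iff matrix_mul_entry cmat_scale_def sum_distrib_left mult.assoc)

lemma cmat_scale_mult_right: "A ** cmat_scale c B = cmat_scale c (A ** B)"
  by (simp add: vec_eq_iff matrix_mul_entry cmat_scale_def sum_distrib_left mult.left_commute)

lemma matrix_mul_zero_left [simp]: "0 ** (A :: complex^'n^'m) = 0"
  by (simp add: vec_eq_iff matrix_mul_entry)

lemma matrix_mul_zero_right [simp]: "(A :: complex^'n^'m) ** 0 = 0"
  by (simp add: vec_eq_iff matrix_mul_entry)

lemma matrix_add_rdistrib: "(A + B) ** (C :: complex^'n^'m) = A ** C + B ** C"
  by (simp add: vec_eq_iff matrix_mul_entry distrib_right sum.distrib)

lemma matrix_vector_mult_sum: "(A :: complex^'n^'m) *v sum g I = (\<Sum>i\<in>I. A *v g i)"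
  by (induction I rule: infinite_finite_induct) (simp_all add: matrix_vector_right_distrib)

lemma sum_matrix_mul: "sum A I ** (B :: complex^'n^'m) = (\<Sum>i\<in>I. A i ** B)"
  by (induction I rule: infinite_finite_induct) (simp_all add: matrix_add_rdistrib)

lemma matrix_mul_sum: "(B :: complex^'n^'m) ** sum A I = (\<Sum>i\<in>I. B ** A i)"
  by (induction I rule: infinite_finite_induct) (simp_all add: matrix_add_ldistrib)

lemma matrix_mul_diff_left: "(A - B) ** (C :: complex^'n^'m) = A ** C - B ** C"
  using matrix_add_rdistrib [of "A - B" B C] by (simp add: algebra_simps)

lemma matrix_mul_diff_right: "(C :: complex^'n^'m) ** (A - B) = C ** A - C ** B"
  using matrix_add_ldistrib [of C "A - B" B] by (simp add: algebra_simps)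

text \<open>The indexed form is for families whose size is known, typically one member per variable.
  The set form that follows suits the maximality argument, where the size is not known in
  advance.\<close>

definition orthogonal_idempotents :: "('i \<Rightarrow> complex^'n^'n) \<Rightarrow> bool" where
  "orthogonal_idempotents e \<longleftrightarrow>
    (\<forall>i j. e i ** e j = (if i = j then e i else 0)) \<and> (\<forall>i. e i \<noteq> 0)"

definition orthogonal_idempotent_set :: "(complex^'n^'n) set \<Rightarrow> bool" where
  "orthogonal_idempotent_set E \<longleftrightarrow>
    (\<forall>a\<in>E. \<forall>b\<in>E. a ** b = (if a = b then a else 0)) \<and> 0 \<notin> E"

lemma orthogonal_idempotents_inj: "orthogonal_idempotents e \<Longrightarrow> inj e"
  unfolding orthogonal_idempotents_def inj_def by metis

lemma orthogonal_idempotents_range: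
  "orthogonal_idempotents e \<Longrightarrow> orthogonal_idempotent_set (range e)"
  unfolding orthogonal_idempotents_def orthogonal_idempotent_set_def by (auto; metis)

lemma orthogonal_idempotent_set_subset:
  "orthogonal_idempotent_set E \<Longrightarrow> F \<subseteq> E \<Longrightarrow> orthogonal_idempotent_set F"
  unfolding orthogonal_idempotent_set_def by blast

lemma orthogonal_idempotent_set_insert:
  assumes E: "orthogonal_idempotent_set E" and x: "x ** x = x" "x \<noteq> 0"
    and orth: "\<And>b. b \<in> E \<Longrightarrow> x ** b = 0 \<and> b ** x = 0"
  shows "orthogonal_idempotent_set (insert x E) \<and> x \<notin> E"
proof -
  have "x \<notin> E" using x orth by force
  moreover have "a ** b = (if a = b then a else 0)" if ab: "a \<in> insert x E" "b \<in> insert x E" for a b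
  proof -
    consider "a = x" "b = x" | "a = x" "b \<in> E" | "a \<in> E" "b = x" | "a \<in> E" "b \<in> E"
      using ab by blast
    then show ?thesis
      using E x orth \<open>x \<notin> E\<close> unfolding orthogonal_idempotent_set_def by cases auto
  qed
  moreover have "0 \<notin> insert x E"
    using E x by (auto simp: orthogonal_idempotent_set_def)
  ultimately show ?thesis
    unfolding orthogonal_idempotent_set_def by blast
qed

lemma orthogonal_idempotent_set_sum_mult:
  assumes "orthogonal_idempotent_set E" "finite S" "S \<subseteq> E" "b \<in> S"
  shows "(\<Sum>a\<in>S. cmat_scale (c a) a) ** b = cmat_scale (c b) b"
proof -
  have "cmat_scale (c a) a ** b = (if a = b then cmat_scale (c b) b else 0)" if "a \<in> S" for a
    using assms that by (auto simp: orthogonal_idempotent_set_def cmat_scale_mult_left cmat.scale_zero_right subset_iff)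
  then have "(\<Sum>a\<in>S. cmat_scale (c a) a) ** b = (\<Sum>a\<in>S. if a = b then cmat_scale (c b) b else 0)"
    unfolding sum_matrix_mul by (intro sum.cong) auto
  then show ?thesis using assms by simp
qed

text \<open>Multiplying a linear relation by a member \<open>b\<close> isolates the term of
  \<open>b\<close>.\<close>

lemma orthogonal_idempotent_set_independent:
  assumes "orthogonal_idempotent_set E"
  shows "cmat.independent E"
  unfolding cmat.independent_explicit_finite_subsets
proof (intro allI impI ballI)
  fix S u b
  assume S: "S \<subseteq> E" "finite S" "(\<Sum>v\<in>S. cmat_scale (u v) v) = 0" "b \<in> S"
  have "cmat_scale (u b) b = 0"
    using orthogonal_idempotent_set_sum_mult [OF assms S(2,1,4), of u] S(3) by simp
  then show "u b = 0"
    using assms S by (auto simp: cmat.scale_eq_0_iff orthogonal_idempotent_set_def)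
qed

text \<open>A nonzero vector is picked in the range of each \<open>e i\<close>. Applying
  \<open>e i\<close> to a vanishing combination isolates its \<open>i\<close>-th term, so these
  vectors form a basis, the columns of \<open>P\<close>.\<close>

lemma orthogonal_idempotents_frame:
  fixes e :: "'n::finite \<Rightarrow> complex^'n^'n"
  assumes "orthogonal_idempotents e"
  obtains P Q where "P ** Q = mat 1" "Q ** P = mat 1"
    "\<And>i j. e i *v column j P = (if i = j then column j P else 0)"
proof -
  have "\<exists>x. e i *v x \<noteq> 0" for i
    using assms unfolding orthogonal_idempotents_def by (metis matrix_eq matrix_vector_mult_0)
  then obtain x where x: "\<And>i. e i *v x i \<noteq> 0" by metis
  define P :: "complex^'n^'n" where "P = (\<chi> a i. (e i *v x i) $ a)"
  have col: "column i P = e i *v x i" for i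
    by (simp add: P_def column_def)
  have act: "e i *v column j P = (if i = j then column j P else 0)" for i j
    using assms by (simp add: col matrix_vector_mul_assoc orthogonal_idempotents_def)
  have "y = 0" if "P *v y = 0" for y
  proof -
    have "y $ i = 0" for i
    proof -
      have "e i *v (P *v y) = (\<Sum>j\<in>UNIV. if j = i then y $ i *s column i P else 0)"
        unfolding matrix_mult_sum [of P y]
        unfolding matrix_vector_mult_sum
        by (intro sum.cong) (auto simp: vector_scalar_commute act)
      then show ?thesis using that x [of i] by (simp add: col)
    qed
    then show ?thesis by (simp add: vec_eq_iff)
  qed
  then have "invertible P"
    by (metis invertible_left_inverse matrix_left_invertible_ker)
  then obtain Q where "P ** Q = mat 1" "Q ** P = mat 1"
    unfolding invertible_def by blast
  then show ?thesis using act that by blast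
qed

section \<open>Idempotents spanning a reduced commutative algebra\<close>

locale comm_matrix_algebra =
  fixes Z :: "(complex^'n::finite^'n) set"
  assumes subspace: "cmat.subspace Z" and mat_1: "mat 1 \<in> Z"
    and mult: "X \<in> Z \<Longrightarrow> Y \<in> Z \<Longrightarrow> X ** Y \<in> Z"
    and commute: "X \<in> Z \<Longrightarrow> Y \<in> Z \<Longrightarrow> X ** Y = Y ** X"
begin

text \<open>Excluding square-zero elements excludes all nilpotents, because some power of a nonzero
  nilpotent is nonzero with square zero.\<close>

definition reduced where "reduced \<longleftrightarrow> (\<forall>X\<in>Z. X ** X = 0 \<longrightarrow> X = 0)"

lemma independent_card_le:
  assumes "cmat.dim Z = CARD('n)" "cmat.independent E" "E \<subseteq> Z"
  shows "finite E \<and> card E \<le> CARD('n)"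
proof -
  obtain B where B: "B \<subseteq> Z" "cmat.independent B" "Z \<subseteq> cmat.span B" "card B = cmat.dim Z"
    using cmat.basis_exists [of Z] by auto
  \<comment> \<open>Infinite sets have \<open>card\<close> equal to \<open>0\<close>, so the
    positive value \<open>CARD('n)\<close> forces finiteness.\<close>
  have "finite B"
    using B(4) assms(1) by (intro card_ge_0_finite) simp
  then show ?thesis
    using cmat.independent_span_bound [of B E] B assms by auto
qed

text \<open>
  A minimal relation \<open>p(W) a = 0\<close> with \<open>p = (x - \<mu>) q\<close> makes \<open>q(W) a\<close> an eigenvector of \<open>W\<close>, hence
  of every polynomial in \<open>W\<close>.
\<close>

lemma exists_eigenvector:
  assumes dim: "cmat.dim Z = CARD('n)" and W: "W \<in> Z" and a: "a \<in> Z" "a ** a = a" "a \<noteq> 0"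
  obtains q \<mu> c where "q \<in> Z" "q \<noteq> 0" "a ** q = q" "W ** q = cmat_scale \<mu> q" "q ** q = cmat_scale c q"
proof -
  \<comment> \<open>These are the products of the powers of \<open>W\<close> with \<open>a\<close>.
    Starting from \<open>a\<close> instead of the identity keeps everything in the ideal generated
    by \<open>a\<close>, on which \<open>a\<close> acts as a unit.\<close>
  define w where "w i = (((**) W) ^^ i) a" for i :: nat
  have w_Z: "w i \<in> Z" for i
    by (induction i) (simp_all add: w_def a W mult)
  have aw: "a ** w i = w i" for i
  proof (induction i)
    case (Suc i)
    have "a ** (W ** w i) = W ** (a ** w i)"
      by (simp add: matrix_mul_assoc commute [OF a(1) W])
    then show ?case using Suc by (simp add: w_def)
  qed (simp add: w_def a)
  \<comment> \<open>The value of the polynomial \<open>p\<close> at \<open>W\<close>, multiplied by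
    \<open>a\<close>.\<close>
  define pv where "pv p = (\<Sum>i\<le>degree p. cmat_scale (coeff p i) (w i))" for p
  have pv_bound: "pv p = (\<Sum>i\<le>N. cmat_scale (coeff p i) (w i))" if "degree p \<le> N" for p N
    unfolding pv_def using that by (intro sum.mono_neutral_left) (auto simp: coeff_eq_0)
  have pv_add: "pv (p + r) = pv p + pv r" for p r
  proof -
    let ?N = "max (degree p) (degree r)"
    have "degree (p + r) \<le> ?N" by (simp add: degree_add_le)
    then show ?thesis
      by (simp add: pv_bound [of _ ?N] cmat.scale_left_distrib sum.distrib)
  qed
  have pv_smult: "pv (smult c p) = cmat_scale c (pv p)" for c p
    by (simp add: pv_bound [of "smult c p" "degree p"] pv_def cmat.scale_sum_right)
  have pv_pCons: "pv (pCons c p) = cmat_scale c a + W ** pv p" for c p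
  proof -
    have "pv (pCons c p) = (\<Sum>i\<le>Suc (degree p). cmat_scale (coeff (pCons c p) i) (w i))"
      by (rule pv_bound) (simp add: degree_pCons_le)
    also have "\<dots> = cmat_scale c (w 0) + (\<Sum>i\<le>degree p. cmat_scale (coeff p i) (w (Suc i)))"
      by (simp add: sum.atMost_Suc_shift del: sum.atMost_Suc)
    finally show ?thesis
      by (simp add: pv_def matrix_mul_sum cmat_scale_mult_right) (simp add: w_def)
  qed
  have pv_0: "pv 0 = 0" by (simp add: pv_def)
  have pv_sum: "pv (sum g I) = (\<Sum>i\<in>I. pv (g i))" for g and I :: "nat set"
    by (induction I rule: infinite_finite_induct) (simp_all add: pv_add pv_0)
  have pv_monom: "pv (monom c i) = cmat_scale c (w i)" for c i
    by (induction i) (simp_all add: monom_0 monom_Suc pv_pCons pv_0 w_def cmat_scale_mult_right)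
  have pv_Z: "pv p \<in> Z" for p
    unfolding pv_def by (intro cmat.subspace_sum [OF subspace] cmat.subspace_scale [OF subspace] w_Z)
  \<comment> \<open>Otherwise the \<open>CARD('n) + 1\<close> matrices \<open>w i\<close> with
    \<open>i \<le> CARD('n)\<close> would be independent, one too many for the dimension.\<close>
  have "\<exists>p. p \<noteq> 0 \<and> pv p = 0"
  proof (rule ccontr)
    assume "\<not> ?thesis"
    then have nz: "p = 0" if "pv p = 0" for p using that by blast
    \<comment> \<open>Independence concerns the set of the \<open>w i\<close>; distinctness ensures
      that it really has \<open>CARD('n) + 1\<close> members.\<close>
    have inj: "inj_on w A" for A
    proof (rule inj_onI)
      fix i j assume "w i = w j"
      then have "pv (monom 1 i + smult (-1) (monom 1 j)) = 0"
        by (simp only: pv_add pv_smult pv_monom) simp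
      then have "monom 1 i + smult (-1) (monom (1::complex) j) = 0" by (rule nz)
      then have "monom 1 i = monom (1::complex) j" by simp
      then show "i = j" by (metis degree_monom_eq one_neq_zero)
    qed
    have "cmat.independent (w ` {..CARD('n)})"
    proof (rule cmat.independent_if_scalars_zero)
      fix u x
      assume sum: "(\<Sum>x\<in>w ` {..CARD('n)}. cmat_scale (u x) x) = 0" and "x \<in> w ` {..CARD('n)}"
      then obtain i where i: "x = w i" "i \<le> CARD('n)" by auto
      have "pv (\<Sum>i\<le>CARD('n). monom (u (w i)) i) = 0"
        using sum by (simp add: pv_sum pv_monom sum.reindex [OF inj])
      then have "coeff (\<Sum>i\<le>CARD('n). monom (u (w i)) i) i = 0" using nz by fastforce
      then show "u x = 0" using i by (simp add: coeff_sum)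
    qed simp
    then have "card (w ` {..CARD('n)}) \<le> CARD('n)"
      using independent_card_le [OF dim] w_Z by blast
    then show False by (simp add: card_image [OF inj])
  qed
  then obtain p where p: "p \<noteq> 0" "pv p = 0" and p_min: "\<And>q. q \<noteq> 0 \<Longrightarrow> pv q = 0 \<Longrightarrow> degree p \<le> degree q"
    using ex_has_least_nat [of "\<lambda>p. p \<noteq> 0 \<and> pv p = 0" _ degree] by blast
  have "degree p \<noteq> 0"
  proof
    assume "degree p = 0"
    then obtain b where "p = [:b:]" by (metis degree_eq_zeroE)
    then show False using p a(3) by (simp add: pv_pCons pv_0)
  qed
  then have "\<not> constant (poly p)" by (simp add: constant_degree)
  then obtain \<mu> where "poly p \<mu> = 0" using fundamental_theorem_of_algebra by blast
  then obtain r where r: "p = [:-\<mu>, 1:] * r" by (metis dvdE poly_eq_0_iff_dvd)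
  have "r \<noteq> 0" using r p by auto
  then have "degree p = Suc (degree r)"
    unfolding r by (subst degree_mult_eq) auto
  \<comment> \<open>The cofactor \<open>r\<close> has smaller degree than the minimal annihilating
    polynomial \<open>p\<close>.\<close>
  then have "pv r \<noteq> 0" using p_min [OF \<open>r \<noteq> 0\<close>] by auto
  have eigen: "W ** pv r = cmat_scale \<mu> (pv r)"
  proof -
    have "pv p = pv (smult (-\<mu>) r + pCons 0 r)" by (simp add: r)
    also have "\<dots> = W ** pv r - cmat_scale \<mu> (pv r)"
      by (simp only: pv_add pv_smult pv_pCons) simp
    finally show ?thesis using p by simp
  qed
  have fixed: "a ** pv s = pv s" for s
    by (simp add: pv_def matrix_mul_sum cmat_scale_mult_right aw)
  \<comment> \<open>Polynomials in \<open>W\<close> act on the eigenvector \<open>pv r\<close> by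
    their value at \<open>\<mu>\<close>. The case \<open>s = r\<close> shows that the square of
    \<open>pv r\<close> is a multiple of it, with \<open>c = poly r \<mu>\<close>.\<close>
  have "pv s ** pv r = cmat_scale (poly s \<mu>) (pv r)" for s
    by (induction s)
      (simp_all add: pv_0 pv_pCons matrix_add_rdistrib cmat_scale_mult_left fixed matrix_mul_assoc [symmetric]
        cmat_scale_mult_right eigen cmat.scale_left_distrib mult.commute)
  then show ?thesis
    using that [of "pv r" \<mu>] \<open>pv r \<noteq> 0\<close> eigen fixed pv_Z by blast
qed

text \<open>Independence bounds the size of orthogonal families, so one of greatest cardinality
  exists. Its members are primitive and add up to the identity; reducedness then makes every
  \<open>W ** a\<close> a multiple of \<open>a\<close>, so the family spans
  \<open>Z\<close>.\<close>

lemma exists_orthogonal_idempotents: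
  assumes dim: "cmat.dim Z = CARD('n)" and red: reduced
  obtains e :: "'n \<Rightarrow> complex^'n^'n" where "orthogonal_idempotents e" "range e \<subseteq> Z"
proof -
  define OI where "OI E \<longleftrightarrow> E \<subseteq> Z \<and> orthogonal_idempotent_set E" for E
  have OI_card: "finite E \<and> card E \<le> CARD('n)" if "OI E" for E
    using that unfolding OI_def
    by (intro independent_card_le [OF dim] orthogonal_idempotent_set_independent) auto
  have "OI {}" by (simp add: OI_def orthogonal_idempotent_set_def)
  moreover have "\<forall>F. OI F \<longrightarrow> card F < Suc CARD('n)"
    using OI_card by (simp add: less_Suc_eq_le)
  ultimately have "\<exists>E. OI E \<and> (\<forall>F. OI F \<longrightarrow> card F \<le> card E)"
    by (rule ex_has_greatest_nat)
  then obtain E where E: "OI E" and max: "\<And>F. OI F \<Longrightarrow> card F \<le> card E" by blast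
  have fin: "finite E" using E OI_card by blast
  have EZ: "a \<in> Z" if "a \<in> E" for a using E that by (auto simp: OI_def)
  have EE: "a ** b = (if a = b then a else 0)" if "a \<in> E" "b \<in> E" for a b
    using E that by (auto simp: OI_def orthogonal_idempotent_set_def)
  have E0: "0 \<notin> E" using E by (auto simp: OI_def orthogonal_idempotent_set_def)
  \<comment> \<open>An idempotent strictly below \<open>a\<close> would split \<open>a\<close> into
    the two orthogonal idempotents \<open>g\<close> and \<open>a - g\<close>, giving a larger
    family.\<close>
  have primitive: "g = a" if a: "a \<in> E" and g: "g \<in> Z" "g ** g = g" "g ** a = g" "g \<noteq> 0" for a g
  proof (rule ccontr)
    assume "g \<noteq> a"
    define h where "h = a - g"
    have hZ: "h \<in> Z" using EZ a g by (simp add: h_def cmat.subspace_diff [OF subspace])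
    have ag: "a ** g = g" using commute [OF EZ [OF a] g(1)] g by simp
    have prods: "g ** h = 0" "h ** g = 0" "h ** h = h" "h ** a = h" "a ** h = h"
      using a g ag EE by (simp_all add: h_def matrix_mul_diff_left matrix_mul_diff_right)
    have "h \<noteq> 0" using \<open>g \<noteq> a\<close> by (simp add: h_def)
    \<comment> \<open>An element absorbed by \<open>a\<close> on both sides inherits the
      orthogonality of \<open>a\<close> to the other members; this covers \<open>g\<close> and
      \<open>h\<close> alike.\<close>
    have orth: "b ** x = 0 \<and> x ** b = 0" if "b \<in> E - {a}" "x ** a = x" "a ** x = x" for b x
    proof -
      have "b ** a = 0" "a ** b = 0" using that EE a by auto
      moreover have "b ** x = (b ** a) ** x" "x ** b = x ** (a ** b)"
        using that by (simp_all add: matrix_mul_assoc [symmetric]) (simp add: matrix_mul_assoc)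
      ultimately show ?thesis by simp
    qed
    have og: "b ** g = 0 \<and> g ** b = 0" if "b \<in> E - {a}" for b
      by (rule orth [OF that g(3) ag])
    have oh: "b ** h = 0 \<and> h ** b = 0" if "b \<in> E - {a}" for b
      by (rule orth [OF that prods(4,5)])
    have "orthogonal_idempotent_set (E - {a})"
      using E by (auto simp: OI_def intro: orthogonal_idempotent_set_subset)
    then have h: "orthogonal_idempotent_set (insert h (E - {a})) \<and> h \<notin> E - {a}"
      using prods \<open>h \<noteq> 0\<close> oh by (intro orthogonal_idempotent_set_insert) auto
    then have gh: "orthogonal_idempotent_set (insert g (insert h (E - {a}))) \<and> g \<notin> insert h (E - {a})"
      using g prods og by (intro orthogonal_idempotent_set_insert) auto
    have "OI (insert g (insert h (E - {a})))"
      using gh EZ g hZ by (auto simp: OI_def)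
    moreover have "card (insert g (insert h (E - {a}))) = Suc (card E)"
      using h gh fin card_Suc_Diff1 [OF fin a] by (simp del: insert_iff card_Diff_insert)
    ultimately show False using max by fastforce
  qed
  have sum_mult: "\<Sum>E ** b = b" if "b \<in> E" for b
    using orthogonal_idempotent_set_sum_mult [of E E b "\<lambda>_. 1"] E fin that by (simp add: OI_def)
  \<comment> \<open>Otherwise the complement \<open>mat 1 - \<Sum>E\<close> is a further nonzero
    idempotent, orthogonal to all members.\<close>
  have sum_E: "\<Sum>E = mat 1"
  proof (rule ccontr)
    define r where "r = mat 1 - \<Sum>E"
    assume "\<Sum>E \<noteq> mat 1"
    then have "r \<noteq> 0" by (simp add: r_def)
    have rZ: "r \<in> Z"
      unfolding r_def
      by (intro cmat.subspace_diff [OF subspace] mat_1 cmat.subspace_sum [OF subspace]) (rule EZ)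
    have rb: "r ** b = 0" if "b \<in> E" for b
      using that by (simp add: r_def matrix_mul_diff_left sum_mult)
    have br: "b ** r = 0" if "b \<in> E" for b
      using that rb commute [OF EZ rZ] by simp
    have "r ** \<Sum>E = 0" by (simp add: matrix_mul_sum rb)
    then have rr: "r ** r = r"
      by (subst (2) r_def) (simp add: matrix_mul_diff_right)
    have r: "orthogonal_idempotent_set (insert r E) \<and> r \<notin> E"
      using E rr rb br \<open>r \<noteq> 0\<close> by (intro orthogonal_idempotent_set_insert) (auto simp: OI_def)
    then have "OI (insert r E)"
      using rZ EZ by (auto simp: OI_def)
    moreover have "card (insert r E) = Suc (card E)"
      using r fin by simp
    ultimately show False using max by fastforce
  qed
  have scalar: "\<exists>\<mu>. W ** a = cmat_scale \<mu> a" if W: "W \<in> Z" and a: "a \<in> E" for W a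
  proof -
    have aa: "a ** a = a" "a \<noteq> 0" using EE a E0 by auto
    obtain q \<mu> c where q: "q \<in> Z" "q \<noteq> 0" "a ** q = q" "W ** q = cmat_scale \<mu> q" "q ** q = cmat_scale c q"
      using exists_eigenvector [OF dim W EZ [OF a] aa] .
    \<comment> \<open>For \<open>c = 0\<close> the nonzero matrix \<open>q\<close> would have square
      zero. After division by \<open>c\<close> it becomes an idempotent below \<open>a\<close>,
      hence equals \<open>a\<close> by primitivity.\<close>
    have "c \<noteq> 0" using q red by (auto simp: reduced_def)
    define g where "g = cmat_scale (inverse c) q"
    have "g = a"
    proof (rule primitive [OF a])
      show "g \<in> Z" by (simp add: g_def q cmat.subspace_scale [OF subspace])
      show "g ** g = g"
        using \<open>c \<noteq> 0\<close> by (simp add: g_def cmat_scale_mult_left cmat_scale_mult_right q)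
      show "g ** a = g"
        using commute [OF EZ [OF a] q(1)] q by (simp add: g_def cmat_scale_mult_left)
      show "g \<noteq> 0" using q \<open>c \<noteq> 0\<close> by (simp add: g_def)
    qed
    then have "a = cmat_scale (inverse c) q" by (simp add: g_def)
    then have "W ** a = cmat_scale \<mu> a"
      by (simp add: cmat_scale_mult_right q mult.commute)
    then show ?thesis ..
  qed
  have "Z \<subseteq> cmat.span E"
  proof
    fix W assume W: "W \<in> Z"
    \<comment> \<open>The family adds up to the identity.\<close>
    have "W = (\<Sum>a\<in>E. W ** a)"
      by (simp add: matrix_mul_sum [symmetric] sum_E)
    also have "\<dots> \<in> cmat.span E"
      using scalar [OF W] by (intro cmat.span_sum) (metis cmat.span_base cmat.span_scale)
    finally show "W \<in> cmat.span E" .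
  qed
  then have "card E = CARD('n)"
    using cmat.basis_card_eq_dim [of E Z] E orthogonal_idempotent_set_independent dim by (auto simp: OI_def)
  then obtain e where e: "bij_betw e (UNIV :: 'n set) E"
    using finite_same_card_bij [of "UNIV :: 'n set" E] fin by auto
  have "orthogonal_idempotents e"
    unfolding orthogonal_idempotents_def
    using e EE E0 by (auto simp: bij_betw_def inj_eq)
  moreover have "range e \<subseteq> Z" using e EZ by (auto simp: bij_betw_def)
  ultimately show ?thesis by (rule that)
qed

end

section \<open>Algebras conjugate to the diagonal matrices\<close>

definition outer_product :: "'a::times^'m \<Rightarrow> 'a^'n \<Rightarrow> 'a^'n^'m" where
  "outer_product u v = (\<chi> i j. u $ i * v $ j)"

lemma outer_product_mult:
  "outer_product u v ** outer_product u' v' = cmat_scale (\<Sum>i\<in>UNIV. v $ i * u' $ i) (outer_product u v')"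
  by (simp add: vec_eq_iff matrix_mul_entry outer_product_def cmat_scale_def sum_distrib_left
    sum_distrib_right ac_simps)

lemma trace_outer_product: "trace (outer_product u v) = (\<Sum>i\<in>UNIV. v $ i * u $ i)"
  for u v :: "complex^'n"
  by (simp add: trace_def outer_product_def mult.commute)

text \<open>All rows are multiples of \<open>v\<close>, and the row at a nonzero entry of
  \<open>u\<close> spans the same line as \<open>v\<close>.\<close>

lemma rank_outer_product:
  fixes u v :: "'a::field^'n"
  assumes "u \<noteq> 0" "v \<noteq> 0"
  shows "rank (outer_product u v) = 1"
proof -
  obtain k where k: "u $ k \<noteq> 0" using assms(1) by (auto simp: vec_eq_iff)
  have row: "row i (outer_product u v) = u $ i *s v" for i
    by (simp add: row_def outer_product_def vec_eq_iff)
  have "vec.span (rows (outer_product u v)) = vec.span {v}"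
  proof (intro equalityI vec.span_minimal vec.subspace_span)
    show "rows (outer_product u v) \<subseteq> vec.span {v}"
      by (auto simp: rows_def row vec.span_base vec.span_scale)
    have "inverse (u $ k) *s row k (outer_product u v) \<in> vec.span (rows (outer_product u v))"
      by (intro vec.span_scale vec.span_base) (auto simp: rows_def)
    then show "{v} \<subseteq> vec.span (rows (outer_product u v))"
      using k by (simp add: row)
  qed
  then have "vec.dim (rows (outer_product u v)) = vec.dim {v}"
    by (metis vec.dim_span)
  then show ?thesis
    using assms(2) by (simp add: row_rank_def_gen)
qed

text \<open>The row space is a line: \<open>v\<close> generates it and \<open>u\<close> collects the
  coefficients of the rows.\<close>

lemma rank_1_imp_outer_product:
  fixes A :: "'a::field^'n^'m"
  assumes "rank A = 1"
  obtains u v where "A = outer_product u v"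
proof -
  obtain B where B: "B \<subseteq> rows A" "vec.independent B" "rows A \<subseteq> vec.span B" "card B = vec.dim (rows A)"
    by (rule vec.basis_exists)
  have "card B = 1" using B(4) assms by (simp add: row_rank_def_gen)
  then obtain v where "B = {v}" by (rule card_1_singletonE)
  then have "\<exists>c. row i A = c *s v" for i
    using B(3) by (auto simp: rows_def vec.span_singleton)
  then obtain c where c: "\<And>i. row i A = c i *s v" by metis
  have "A = outer_product (\<chi> i. c i) v"
    using c by (simp add: vec_eq_iff row_def outer_product_def)
  then show ?thesis by (rule that)
qed

text \<open>Trace 1 makes a matrix of rank 1 idempotent. Commutativity then gives
  \<open>X Y X = X Y = Y X Y\<close>, while outer products give
  \<open>X Y X = \<alpha> \<beta> X\<close> and \<open>Y X Y = \<alpha> \<beta> Y\<close>. Either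
  \<open>\<alpha> \<beta>\<close> is zero and the product vanishes, or \<open>X = Y\<close>.\<close>

lemma rank_1_trace_1_products:
  fixes X Y :: "complex^'n::finite^'n"
  assumes X: "rank X = 1" "trace X = 1" and Y: "rank Y = 1" "trace Y = 1" and XY: "X ** Y = Y ** X"
  shows "X ** Y = (if X = Y then X else 0)"
proof -
  obtain u v where uv: "X = outer_product u v" using rank_1_imp_outer_product [OF X(1)] .
  obtain u' v' where uv': "Y = outer_product u' v'" using rank_1_imp_outer_product [OF Y(1)] .
  define \<alpha> where "\<alpha> = (\<Sum>i\<in>UNIV. v $ i * u' $ i)"
  define \<beta> where "\<beta> = (\<Sum>i\<in>UNIV. v' $ i * u $ i)"
  have XX: "X ** X = X" using X(2) by (simp add: uv trace_outer_product outer_product_mult)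
  have YY: "Y ** Y = Y" using Y(2) by (simp add: uv' trace_outer_product outer_product_mult)
  have 1: "X ** Y = cmat_scale \<alpha> (outer_product u v')"
    by (simp add: uv uv' outer_product_mult \<alpha>_def)
  have 2: "Y ** X = cmat_scale \<beta> (outer_product u' v)"
    by (simp add: uv uv' outer_product_mult \<beta>_def)
  have "X ** Y ** X = cmat_scale (\<alpha> * \<beta>) X"
    by (simp add: 1 cmat_scale_mult_left) (simp add: uv outer_product_mult \<beta>_def)
  moreover have "X ** Y ** X = X ** Y"
  proof -
    have "X ** Y ** X = X ** X ** Y" by (simp only: XY [symmetric] matrix_mul_assoc [symmetric])
    then show ?thesis by (simp only: XX)
  qed
  ultimately have X': "X ** Y = cmat_scale (\<alpha> * \<beta>) X" by simp
  have "Y ** X ** Y = cmat_scale (\<alpha> * \<beta>) Y"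
    by (simp add: 2 cmat_scale_mult_left) (simp add: uv' outer_product_mult \<alpha>_def mult.commute)
  moreover have "Y ** X ** Y = X ** Y"
  proof -
    have "Y ** X ** Y = Y ** Y ** X" by (simp only: XY matrix_mul_assoc [symmetric])
    then show ?thesis by (simp only: YY XY)
  qed
  ultimately have Y': "X ** Y = cmat_scale (\<alpha> * \<beta>) Y" by simp
  show ?thesis
  proof (cases "\<alpha> * \<beta> = 0")
    case True
    then have "X ** Y = 0" using X' by simp
    then show ?thesis using XX by auto
  next
    case False
    then have "X = Y" using X' Y' by (metis cmat.scale_cancel_left)
    then show ?thesis using XX by simp
  qed
qed

definition matrix_unit :: "'n \<Rightarrow> complex^'n^'n" where
  "matrix_unit k = (\<chi> i j. if i = k \<and> j = k then 1 else 0)"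

lemma matrix_unit_mult: "matrix_unit i ** matrix_unit j = (if i = j then matrix_unit i else 0)"
proof -
  have "(\<Sum>k\<in>UNIV. (if a = i \<and> k = i then 1 else 0) * (if k = j \<and> b = j then 1 else 0)) =
      (\<Sum>k\<in>UNIV. if k = i then if a = i \<and> i = j \<and> b = j then 1 else 0 else (0::complex))" for a b
    by (intro sum.cong) auto
  then show ?thesis
    by (auto simp: vec_eq_iff matrix_mul_entry matrix_unit_def)
qed

lemma matrix_unit_nonzero: "matrix_unit i \<noteq> 0"
  by (auto simp: vec_eq_iff matrix_unit_def intro!: exI [of _ i])

lemma is_diagonal_matrix_unit: "is_diagonal (matrix_unit i)"
  by (simp add: is_diagonal_def matrix_unit_def)

lemma is_diagonal_square_0:
  assumes "is_diagonal D" "D ** D = 0"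
  shows "D = 0"
proof -
  have "D $ i $ j = 0" for i j
  proof (cases "i = j")
    case True
    have "(D ** D) $ i $ i = (\<Sum>k\<in>UNIV. if k = i then D $ i $ i * D $ i $ i else 0)"
      unfolding matrix_mul_entry using assms(1) by (intro sum.cong) (auto simp: is_diagonal_def)
    then show ?thesis using assms(2) True by simp
  qed (use assms(1) in \<open>simp add: is_diagonal_def\<close>)
  then show ?thesis by (simp add: vec_eq_iff)
qed

lemma matrix_inv_cancel:
  assumes "invertible A"
  shows "A ** matrix_inv A = mat 1" "matrix_inv A ** A = mat 1"
  using someI_ex [OF assms [unfolded invertible_def]] by (simp_all add: matrix_inv_def)

text \<open>Conjugation preserves the relation, and the square of a diagonal matrix has the squares
  of its entries on the diagonal.\<close>

lemma diagonalizable_matrix_square_0: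
  fixes X :: "complex^'n::finite^'n"
  assumes "diagonalizable_matrix X" "X ** X = 0"
  shows "X = 0"
proof -
  obtain P :: "complex^'n^'n" where P: "invertible P" "is_diagonal (matrix_inv P ** X ** P)"
    using assms(1) by (auto simp: diagonalizable_matrix_def)
  have inv: "P ** matrix_inv P = mat 1" "matrix_inv P ** P = mat 1"
    using P(1) by (simp_all add: matrix_inv_cancel)
  let ?D = "matrix_inv P ** X ** P"
  have "?D ** ?D = matrix_inv P ** X ** (P ** matrix_inv P) ** X ** P"
    by (simp add: matrix_mul_assoc)
  also have "\<dots> = matrix_inv P ** (X ** X) ** P"
    by (simp add: inv) (simp add: matrix_mul_assoc)
  also have "\<dots> = 0" using assms(2) by simp
  finally have "?D = 0" using is_diagonal_square_0 P(2) by blast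
  then have "P ** ?D ** matrix_inv P = 0" by simp
  moreover have "P ** ?D ** matrix_inv P = (P ** matrix_inv P) ** X ** (P ** matrix_inv P)"
    by (simp add: matrix_mul_assoc)
  ultimately show ?thesis by (simp add: inv)
qed

section \<open>Idempotents or reducedness from properties of the algebra\<close>

context comm_matrix_algebra
begin

text \<open>The preimages of the diagonal matrix units satisfy the same relations, because the
  isomorphism is multiplicative, injective and maps \<open>0\<close> to \<open>0\<close>.\<close>

lemma isomorphic_imp_orthogonal_idempotents:
  assumes "cmat_alg_isomorphic Z diagonal_algebra"
  obtains e :: "'n \<Rightarrow> complex^'n^'n" where "orthogonal_idempotents e" "range e \<subseteq> Z"
proof -
  obtain \<phi> :: "complex^'n^'n \<Rightarrow> complex^'n^'n" where bij: "bij_betw \<phi> Z diagonal_algebra"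
    and hom: "\<And>X Y. X \<in> Z \<Longrightarrow> Y \<in> Z \<Longrightarrow> \<phi> (X ** Y) = \<phi> X ** \<phi> Y"
    and scale: "\<And>c X. X \<in> Z \<Longrightarrow> \<phi> (cmat_scale c X) = cmat_scale c (\<phi> X)"
    using assms unfolding cmat_alg_isomorphic_def by blast
  have "\<exists>X\<in>Z. \<phi> X = matrix_unit i" for i
    using bij is_diagonal_matrix_unit [of i] by (force simp: bij_betw_def diagonal_algebra_def image_iff)
  then obtain e where e: "\<And>i. e i \<in> Z" "\<And>i. \<phi> (e i) = matrix_unit i" by metis
  have Z0: "0 \<in> Z" by (rule cmat.subspace_0 [OF subspace])
  have \<phi>0: "\<phi> 0 = 0" using scale [OF Z0, of 0] by simp
  have inj: "X = Y" if "X \<in> Z" "Y \<in> Z" "\<phi> X = \<phi> Y" for X Y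
    using bij that by (auto simp: bij_betw_def inj_on_def)
  have "e i ** e j = (if i = j then e i else 0)" for i j
  proof (rule inj)
    show "e i ** e j \<in> Z" using e by (simp add: mult)
    show "(if i = j then e i else 0) \<in> Z" using e Z0 by simp
    show "\<phi> (e i ** e j) = \<phi> (if i = j then e i else 0)"
      using e by (simp add: hom matrix_unit_mult \<phi>0)
  qed
  moreover have "e i \<noteq> 0" for i
    using e(2) [of i] \<phi>0 matrix_unit_nonzero [of i] by auto
  ultimately show ?thesis
    using e by (intro that [of e]) (auto simp: orthogonal_idempotents_def)
qed

text \<open>By commutativity, multiplication by \<open>X\<close> maps a minimal ideal
  \<open>L i\<close> onto an ideal inside it. The image is zero or all of \<open>L i\<close>; as
  \<open>X ** X = 0\<close>, in both cases \<open>X\<close> annihilates \<open>L i\<close>. So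
  \<open>X\<close> annihilates the sum of these ideals, which contains the identity.\<close>

lemma semisimple_imp_reduced:
  assumes "semisimple_algebra Z"
  shows reduced
  unfolding reduced_def
proof (intro ballI impI)
  fix X assume X: "X \<in> Z" "X ** X = 0"
  obtain k :: nat and L where L: "\<And>i. i < k \<Longrightarrow> minimal_left_ideal_of Z (L i)"
    and Z: "Z = {\<Sum>i<k. Y i | Y. \<forall>i<k. Y i \<in> L i}"
    using assms unfolding semisimple_algebra_def by blast
  have annihilates: "X ** Y = 0" if i: "i < k" and Y: "Y \<in> L i" for i Y
  proof -
    have ideal: "L i \<subseteq> Z" "cmat.subspace (L i)" "\<And>A B. A \<in> Z \<Longrightarrow> B \<in> L i \<Longrightarrow> A ** B \<in> L i"
      using L [OF i] by (auto simp: minimal_left_ideal_of_def left_ideal_of_def)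
    define K where "K = (**) X ` L i"
    have "left_ideal_of Z K"
      unfolding left_ideal_of_def
    proof (intro conjI ballI)
      show "K \<subseteq> Z" using ideal X by (auto simp: K_def intro: mult)
      show "cmat.subspace K"
        unfolding cmat.subspace_def K_def
      proof (intro conjI ballI allI)
        show "0 \<in> (**) X ` L i"
          by (rule image_eqI [of _ _ 0]) (simp_all add: cmat.subspace_0 [OF ideal(2)])
      next
        fix A B assume "A \<in> (**) X ` L i" "B \<in> (**) X ` L i"
        then obtain A' B' where *: "A' \<in> L i" "B' \<in> L i" "A = X ** A'" "B = X ** B'" by auto
        show "A + B \<in> (**) X ` L i"
          by (rule image_eqI [of _ _ "A' + B'"])
            (simp_all add: * matrix_add_ldistrib cmat.subspace_add [OF ideal(2)])
      next
        fix c A assume "A \<in> (**) X ` L i"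
        then obtain A' where *: "A' \<in> L i" "A = X ** A'" by auto
        show "cmat_scale c A \<in> (**) X ` L i"
          by (rule image_eqI [of _ _ "cmat_scale c A'"])
            (simp_all add: * cmat_scale_mult_right cmat.subspace_scale [OF ideal(2)])
      qed
    next
      fix A B assume A: "A \<in> Z" and "B \<in> K"
      then obtain B' where B: "B' \<in> L i" "B = X ** B'" by (auto simp: K_def)
      have "A ** B = X ** (A ** B')"
        using commute [OF A X(1)] by (simp add: B matrix_mul_assoc)
      then show "A ** B \<in> K" using ideal(3) [OF A B(1)] by (simp add: K_def)
    qed
    moreover have "K \<subseteq> L i" using ideal(3) X by (auto simp: K_def)
    ultimately consider "K = {0}" | "K = L i"
      using L [OF i] by (auto simp: minimal_left_ideal_of_def)
    then show ?thesis
    proof cases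
      case 1
      then show ?thesis using Y by (auto simp: K_def)
    next
      \<comment> \<open>Every member of \<open>L i\<close> is now a multiple \<open>X ** Y'\<close>,
        which another factor \<open>X\<close> kills.\<close>
      case 2
      then obtain Y' where Y': "Y' \<in> L i" "Y = X ** Y'" using Y by (auto simp: K_def)
      then show ?thesis by (simp add: matrix_mul_assoc X)
    qed
  qed
  obtain Y where Y: "mat 1 = (\<Sum>i<k. Y i)" "\<And>i. i < k \<Longrightarrow> Y i \<in> L i"
    using mat_1 unfolding Z by blast
  have "X = X ** mat 1" by simp
  also have "\<dots> = (\<Sum>i<k. X ** Y i)" unfolding Y(1) by (rule matrix_mul_sum)
  also have "\<dots> = 0" using annihilates Y(2) by simp
  finally show "X = 0" .
qed

text \<open>A nonzero square-zero \<open>X\<close> can be extended to a basis of \<open>Z\<close>,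
  which makes it diagonalizable and hence zero.\<close>

lemma diagonalizable_bases_imp_reduced:
  assumes "\<And>B X. cmat_basis B Z \<Longrightarrow> X \<in> B \<Longrightarrow> diagonalizable_matrix X"
  shows reduced
  unfolding reduced_def
proof (intro ballI impI)
  fix X assume X: "X \<in> Z" "X ** X = 0"
  show "X = 0"
  proof (rule ccontr)
    assume "X \<noteq> 0"
    then obtain B where B: "{X} \<subseteq> B" "B \<subseteq> Z" "cmat.independent B" "Z \<subseteq> cmat.span B"
      using cmat.maximal_independent_subset_extend [of "{X}" Z] X(1) by auto
    have "cmat.span B = Z"
      using B subspace by (intro equalityI cmat.span_minimal)
    then have "cmat_basis B Z" using B by (simp add: cmat_basis_def)
    then have "diagonalizable_matrix X" using assms B(1) by blast
    then show False using diagonalizable_matrix_square_0 X(2) \<open>X \<noteq> 0\<close> by blast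
  qed
qed

text \<open>The members of the basis commute, so \<open>rank_1_trace_1_products\<close> makes them
  orthogonal idempotents; the dimension provides exactly one for each variable.\<close>

lemma rank_1_basis_imp_orthogonal_idempotents:
  assumes dim: "cmat.dim Z = CARD('n)" and B: "cmat_basis B Z"
    and rank: "\<And>X. X \<in> B \<Longrightarrow> rank X = 1 \<and> trace X = 1"
  obtains e :: "'n \<Rightarrow> complex^'n^'n" where "orthogonal_idempotents e" "range e \<subseteq> Z"
proof -
  have BZ: "B \<subseteq> Z" and "cmat.independent B" "Z \<subseteq> cmat.span B"
    using B by (auto simp: cmat_basis_def)
  then have card: "card B = CARD('n)"
    using cmat.basis_card_eq_dim dim by metis
  then have "finite B" by (intro card_ge_0_finite) simp
  then obtain e where e: "bij_betw e (UNIV :: 'n set) B"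
    using finite_same_card_bij [of "UNIV :: 'n set" B] card by auto
  then have eB: "e i \<in> B" for i by (auto simp: bij_betw_def)
  have "inj e" using e by (simp add: bij_betw_def)
  have "e i ** e j = (if i = j then e i else 0)" for i j
  proof -
    have "e i ** e j = e j ** e i" using eB BZ by (intro commute) auto
    then show ?thesis
      using rank_1_trace_1_products [of "e i" "e j"] rank [OF eB] \<open>inj e\<close> by (simp add: inj_eq)
  qed
  moreover have "e i \<noteq> 0" for i
    using rank [OF eB [of i]] by (auto simp: trace_def)
  ultimately show ?thesis
    using eB BZ by (intro that [of e]) (auto simp: orthogonal_idempotents_def)
qed

end

section \<open>Matrices diagonal in a fixed basis\<close>

text \<open>The columns of \<open>P\<close> are the basis vectors and the rows of \<open>Q\<close>
  the dual coordinates.\<close>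

locale diagonal_frame =
  fixes P Q :: "complex^'n::finite^'n"
  assumes PQ: "P ** Q = mat 1" and QP: "Q ** P = mat 1"
begin

definition conj_diagonals where
  "conj_diagonals = {X. is_diagonal (Q ** X ** P)}"

text \<open>The projection onto the line of the \<open>k\<close>-th basis vector along the other
  basis vectors.\<close>

definition idem where
  "idem k = outer_product (column k P) (Q $ k)"

lemma conj_cancel: "Q ** (P ** X ** Q) ** P = X" "P ** (Q ** X ** P) ** Q = X"
proof -
  have "Q ** (P ** X ** Q) ** P = (Q ** P) ** X ** (Q ** P)"
    by (simp add: matrix_mul_assoc)
  then show "Q ** (P ** X ** Q) ** P = X" by (simp add: QP)
  have "P ** (Q ** X ** P) ** Q = (P ** Q) ** X ** (P ** Q)"
    by (simp add: matrix_mul_assoc)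
  then show "P ** (Q ** X ** P) ** Q = X" by (simp add: PQ)
qed

lemma pairing: "(\<Sum>a\<in>UNIV. Q $ i $ a * column j P $ a) = (if i = j then 1 else 0)"
proof -
  have "(\<Sum>a\<in>UNIV. Q $ i $ a * column j P $ a) = (Q ** P) $ i $ j"
    by (simp add: matrix_mul_entry column_def)
  then show ?thesis by (simp add: QP mat_def)
qed

lemma trace_idem: "trace (idem k) = 1"
  by (simp add: idem_def trace_outer_product pairing)

lemma rank_idem: "rank (idem k) = 1"
  unfolding idem_def
proof (rule rank_outer_product)
  show "column k P \<noteq> 0" "Q $ k \<noteq> 0"
    using pairing [of k k] by auto
qed

lemma orthogonal_idempotents_idem: "orthogonal_idempotents idem"
proof -
  have "idem k \<noteq> 0" for k
    using trace_idem [of k] by (auto simp: trace_def)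
  moreover have "idem i ** idem j = (if i = j then idem i else 0)" for i j
    by (simp add: idem_def outer_product_mult pairing)
  ultimately show ?thesis
    by (simp add: orthogonal_idempotents_def)
qed

text \<open>Conjugation turns \<open>idem k\<close> into \<open>matrix_unit k\<close>, so the
  coefficients are the diagonal entries of \<open>Q ** X ** P\<close>.\<close>

lemma conj_diagonals_eq: "conj_diagonals = {\<Sum>k\<in>UNIV. cmat_scale (c k) (idem k) | c. True}"
proof -
  have idem: "Q ** idem k ** P = matrix_unit k" for k
  proof -
    have "(Q ** idem k ** P) $ i $ j = (\<Sum>a\<in>UNIV. Q $ i $ a * column k P $ a) * (\<Sum>b\<in>UNIV. Q $ k $ b * column j P $ b)"
      for i j
      by (simp add: matrix_mul_entry idem_def outer_product_def column_def sum_product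
        sum_distrib_right mult.assoc) (subst sum.swap, simp add: sum_distrib_left)
    then show ?thesis by (simp add: vec_eq_iff pairing matrix_unit_def)
  qed
  have sum: "Q ** (\<Sum>k\<in>UNIV. cmat_scale (c k) (idem k)) ** P = (\<Sum>k\<in>UNIV. cmat_scale (c k) (matrix_unit k))" for c
    by (simp add: matrix_mul_sum sum_matrix_mul cmat_scale_mult_left cmat_scale_mult_right idem)
  have entry: "(\<Sum>k\<in>UNIV. cmat_scale (c k) (matrix_unit k) $ i $ j) = (if i = j then c i else 0)" for c and i j :: 'n
  proof -
    have "cmat_scale (c k) (matrix_unit k) $ i $ j = (if k = i then if i = j then c i else 0 else 0)" for k
      by (auto simp: cmat_scale_def matrix_unit_def)
    then show ?thesis by simp
  qed
  show ?thesis
  proof (intro equalityI subsetI)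
    fix X assume "X \<in> conj_diagonals"
    then have X: "is_diagonal (Q ** X ** P)" by (simp add: conj_diagonals_def)
    define c where "c k = (Q ** X ** P) $ k $ k" for k
    have "Q ** (\<Sum>k\<in>UNIV. cmat_scale (c k) (idem k)) ** P = Q ** X ** P"
      using X by (simp add: sum vec_eq_iff entry c_def is_diagonal_def)
    then have "X = (\<Sum>k\<in>UNIV. cmat_scale (c k) (idem k))"
      by (metis conj_cancel(2))
    then show "X \<in> {\<Sum>k\<in>UNIV. cmat_scale (c k) (idem k) | c. True}" by blast
  next
    fix X assume "X \<in> {\<Sum>k\<in>UNIV. cmat_scale (c k) (idem k) | c. True}"
    then obtain c where "X = (\<Sum>k\<in>UNIV. cmat_scale (c k) (idem k))" by blast
    then show "X \<in> conj_diagonals"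
      by (simp add: conj_diagonals_def sum is_diagonal_def entry)
  qed
qed

lemma cmat_basis_idem: "cmat_basis (range idem) conj_diagonals"
proof -
  have inj: "inj idem" using orthogonal_idempotents_idem by (rule orthogonal_idempotents_inj)
  have "conj_diagonals = (\<Union>c. {\<Sum>X\<in>range idem. cmat_scale (c X) X})" (is "_ = ?R")
  proof (intro equalityI subsetI)
    fix X assume "X \<in> conj_diagonals"
    then obtain c where "X = (\<Sum>k\<in>UNIV. cmat_scale (c k) (idem k))"
      unfolding conj_diagonals_eq by blast
    \<comment> \<open>The description of a finite span takes coefficients indexed by the matrices
      themselves; \<open>inv idem\<close> recovers the index.\<close>
    then have "X = (\<Sum>Y\<in>range idem. cmat_scale (c (inv idem Y)) Y)"
      by (simp add: sum.reindex [OF inj] inv_f_f [OF inj])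
    then show "X \<in> ?R" by (intro UN_I [of "\<lambda>Y. c (inv idem Y)"]) simp_all
  next
    fix X assume "X \<in> ?R"
    then obtain c where "X = (\<Sum>Y\<in>range idem. cmat_scale (c Y) Y)" by blast
    then have "X = (\<Sum>k\<in>UNIV. cmat_scale (c (idem k)) (idem k))"
      by (simp add: sum.reindex [OF inj])
    then show "X \<in> conj_diagonals"
      unfolding conj_diagonals_eq by (intro CollectI exI [of _ "\<lambda>k. c (idem k)"]) simp
  qed
  then have span: "cmat.span (range idem) = conj_diagonals"
    by (simp add: cmat.span_finite UNION_singleton_eq_range)
  show ?thesis
    unfolding cmat_basis_def span
    using orthogonal_idempotent_set_independent orthogonal_idempotents_range orthogonal_idempotents_idem
      cmat.span_superset span by blast
qed

lemma dim_conj_diagonals: "cmat.dim conj_diagonals = CARD('n)"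
proof -
  have "cmat.dim conj_diagonals = card (range idem)"
    using cmat_basis_idem cmat.dim_span_eq_card_independent [of "range idem"]
    unfolding cmat_basis_def by simp
  then show ?thesis
    by (simp add: card_image orthogonal_idempotents_inj orthogonal_idempotents_idem)
qed

lemma conj_diagonals_isomorphic: "cmat_alg_isomorphic conj_diagonals diagonal_algebra"
  unfolding cmat_alg_isomorphic_def
proof (intro exI [of _ "\<lambda>X. Q ** X ** P"] conjI ballI allI)
  show "bij_betw (\<lambda>X. Q ** X ** P) conj_diagonals diagonal_algebra"
    by (rule bij_betw_byWitness [where f' = "\<lambda>X. P ** X ** Q"])
      (auto simp: conj_cancel conj_diagonals_def diagonal_algebra_def)
  show "Q ** mat 1 ** P = mat 1" by (simp add: QP)
  fix X Y :: "complex^'n^'n" and c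
  show "Q ** (X + Y) ** P = Q ** X ** P + Q ** Y ** P"
    by (simp add: matrix_add_ldistrib matrix_add_rdistrib)
  show "Q ** cmat_scale c X ** P = cmat_scale c (Q ** X ** P)"
    by (simp add: cmat_scale_mult_left cmat_scale_mult_right)
  have "Q ** X ** P ** (Q ** Y ** P) = Q ** X ** (P ** Q) ** Y ** P"
    by (simp add: matrix_mul_assoc)
  then show "Q ** (X ** Y) ** P = Q ** X ** P ** (Q ** Y ** P)"
    by (simp add: PQ matrix_mul_assoc)
qed

lemma conj_diagonals_diagonalizable:
  assumes "X \<in> conj_diagonals"
  shows "diagonalizable_matrix X"
proof -
  have inv: "invertible P" using PQ QP by (auto simp: invertible_def)
  then have "P ** matrix_inv P = mat 1" by (rule matrix_inv_cancel)
  then have "Q = matrix_inv P"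
    by (metis QP matrix_mul_assoc matrix_mul_lid matrix_mul_rid)
  then show ?thesis
    using assms inv unfolding diagonalizable_matrix_def conj_diagonals_def by blast
qed

text \<open>The lines spanned by the idempotents \<open>idem k\<close> are minimal ideals, and the
  algebra is their direct sum.\<close>

lemma conj_diagonals_semisimple: "semisimple_algebra conj_diagonals"
proof -
  have oi: "idem i ** idem j = (if i = j then idem i else 0)" "idem i \<noteq> 0" for i j
    using orthogonal_idempotents_idem by (auto simp: orthogonal_idempotents_def)
  define N where "N = CARD('n)"
  \<comment> \<open>The definition of semisimplicity numbers the summands by naturals, so the
    variables are enumerated.\<close>
  obtain g :: "nat \<Rightarrow> 'n" where g: "bij_betw g {..<N} UNIV"
    using finite_same_card_bij [of "{..<N}" "UNIV :: 'n set"] by (auto simp: N_def)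
  have inj: "inj_on g {..<N}" and range: "g ` {..<N} = UNIV" using g by (auto simp: bij_betw_def)
  define L where "L i = range (\<lambda>c. cmat_scale c (idem (g i)))" for i
  have mult: "(\<Sum>k\<in>UNIV. cmat_scale (c k) (idem k)) ** idem i = cmat_scale (c i) (idem i)" for c i
  proof -
    have "(\<Sum>k\<in>UNIV. cmat_scale (c k) (idem k)) ** idem i =
        (\<Sum>k\<in>UNIV. if k = i then cmat_scale (c i) (idem i) else 0)"
      unfolding sum_matrix_mul by (intro sum.cong) (auto simp: cmat_scale_mult_left oi)
    then show ?thesis by simp
  qed
  have mem: "cmat_scale c (idem k) \<in> conj_diagonals" for c k
    using cmat_basis_idem unfolding cmat_basis_def by (metis cmat.span_base cmat.span_scale rangeI)
  have "minimal_left_ideal_of conj_diagonals (L i)" for i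
    unfolding minimal_left_ideal_of_def
  proof (intro conjI allI impI)
    show "left_ideal_of conj_diagonals (L i)"
      unfolding left_ideal_of_def
    proof (intro conjI ballI)
      show "L i \<subseteq> conj_diagonals" by (auto simp: L_def mem)
      have "L i = cmat.span {idem (g i)}" by (simp add: L_def cmat.span_singleton)
      then show "cmat.subspace (L i)" by simp
      fix X Y assume "X \<in> conj_diagonals" "Y \<in> L i"
      then obtain c b where "X = (\<Sum>k\<in>UNIV. cmat_scale (c k) (idem k))" "Y = cmat_scale b (idem (g i))"
        unfolding conj_diagonals_eq L_def by blast
      then have "X ** Y = cmat_scale (b * c (g i)) (idem (g i))"
        by (simp add: cmat_scale_mult_right mult)
      then show "X ** Y \<in> L i" unfolding L_def by (rule range_eqI)
    qed
    have "cmat_scale 1 (idem (g i)) \<in> L i" unfolding L_def by blast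
    then show "L i \<noteq> {0}" using oi(2) [of "g i"] by auto
    fix K assume K: "left_ideal_of conj_diagonals K \<and> K \<subseteq> L i"
    then have sub: "cmat.subspace K" by (simp add: left_ideal_of_def)
    show "K = {0} \<or> K = L i"
    proof (cases "K \<subseteq> {0}")
      case True
      then show ?thesis using cmat.subspace_0 [OF sub] by auto
    next
      case False
      then obtain c where c: "cmat_scale c (idem (g i)) \<in> K" "c \<noteq> 0"
        using K by (auto simp: L_def subset_iff image_iff)
      have "cmat_scale b (idem (g i)) \<in> K" for b
        using cmat.subspace_scale [OF sub c(1), of "b / c"] c(2) by simp
      then show ?thesis using K by (auto simp: L_def)
    qed
  qed
  moreover have "conj_diagonals = {\<Sum>i<N. Y i | Y. \<forall>i<N. Y i \<in> L i}"
  proof (intro equalityI subsetI)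
    fix X assume "X \<in> conj_diagonals"
    then obtain c where "X = (\<Sum>k\<in>g ` {..<N}. cmat_scale (c k) (idem k))"
      unfolding conj_diagonals_eq range by blast
    then have "X = (\<Sum>i<N. cmat_scale (c (g i)) (idem (g i)))"
      by (simp add: sum.reindex [OF inj])
    moreover have "\<forall>i<N. cmat_scale (c (g i)) (idem (g i)) \<in> L i" by (auto simp only: L_def)
    ultimately show "X \<in> {\<Sum>i<N. Y i | Y. \<forall>i<N. Y i \<in> L i}" by blast
  next
    fix X assume "X \<in> {\<Sum>i<N. Y i | Y. \<forall>i<N. Y i \<in> L i}"
    then obtain Y where Y: "X = (\<Sum>i<N. Y i)" "\<forall>i<N. Y i \<in> L i" by blast
    have "Y i \<in> conj_diagonals" if "i < N" for i using Y(2) that mem by (auto simp: L_def)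
    moreover have "cmat.subspace conj_diagonals"
      using cmat_basis_idem by (metis cmat_basis_def cmat.subspace_span)
    ultimately show "X \<in> conj_diagonals"
      unfolding Y(1) by (intro cmat.subspace_sum) auto
  qed
  moreover have "\<forall>i<N. Y i = 0" if Y: "\<forall>i<N. Y i \<in> L i" "(\<Sum>i<N. Y i) = 0" for Y
  proof (intro allI impI)
    fix i assume i: "i < N"
    have "\<forall>j. \<exists>c. j < N \<longrightarrow> Y j = cmat_scale c (idem (g j))" using Y(1) by (auto simp: L_def)
    then obtain c where c: "\<And>j. j < N \<Longrightarrow> Y j = cmat_scale (c j) (idem (g j))" by metis
    \<comment> \<open>Multiplying by one idempotent isolates the corresponding summand, which proves
      directness.\<close>
    have "(\<Sum>j<N. Y j) ** idem (g i) = (\<Sum>j<N. if j = i then Y i else 0)"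
      unfolding sum_matrix_mul
      using i inj by (intro sum.cong) (auto simp: c cmat_scale_mult_left oi inj_on_eq_iff)
    then show "Y i = 0" using Y(2) i by simp
  qed
  ultimately show ?thesis
    unfolding semisimple_algebra_def by blast
qed

end

section \<open>Sums of powers of linear forms\<close>

lemma const_poly_eq_0_iff [simp]: "const_poly c = 0 \<longleftrightarrow> c = 0"
  using const_poly_mult_eq_0_iff [of c 1] by simp

lemma const_poly_inverse_mult:
  assumes "of_nat (Suc m) * p = q"
  shows "p = const_poly (inverse (of_nat (Suc m))) * q"
proof -
  have "const_poly (inverse (of_nat (Suc m))) * q =
      const_poly (inverse (of_nat (Suc m)) * of_nat (Suc m)) * p"
    unfolding assms [symmetric] const_poly_mult const_poly_of_nat by (simp only: mult.assoc)
  also have "inverse (of_nat (Suc m)) * of_nat (Suc m) = (1 :: complex)"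
    by (rule left_inverse) (simp only: of_nat_eq_0_iff; simp)
  finally show ?thesis by simp
qed

lemma sum_eq_single:
  assumes "finite A" "k \<in> A" "\<And>i. i \<in> A \<Longrightarrow> i \<noteq> k \<Longrightarrow> g i = 0"
  shows "sum g A = g k"
proof -
  have "sum g A = sum g {k}"
    using assms by (intro sum.mono_neutral_right) auto
  then show ?thesis by simp
qed

context diagonal_frame
begin

lemma dir_deriv_frame: "dir_deriv (column i P) (lin_form (Q $ j)) = const_poly (if i = j then 1 else 0)"
  unfolding dir_deriv_lin_form pairing by (cases "i = j") simp_all

text \<open>Such a form depends on the \<open>i\<close>-th coordinate only. By induction its
  derivative in direction \<open>i\<close> is a multiple of a power of that coordinate, and Euler's
  identity in the frame, with one surviving term, recovers the form.\<close>

lemma power_of_coordinate: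
  assumes "homogeneous m g" "\<And>j. j \<noteq> i \<Longrightarrow> dir_deriv (column j P) g = 0"
  obtains c where "g = const_poly c * lin_form (Q $ i) ^ m"
proof -
  have "\<exists>c. g = const_poly c * lin_form (Q $ i) ^ m"
    using assms
  proof (induction m arbitrary: g)
    case 0
    then show ?case by (metis homogeneous_0_imp_const mult.right_neutral power_0)
  next
    case (Suc m)
    have "homogeneous m (dir_deriv (column i P) g)"
      using Suc.prems(1) by (rule homogeneous_dir_deriv)
    moreover have "dir_deriv (column j P) (dir_deriv (column i P) g) = 0" if "j \<noteq> i" for j
      using Suc.prems(2) [OF that] by (subst dir_deriv_commute) simp
    ultimately obtain c where c: "dir_deriv (column i P) g = const_poly c * lin_form (Q $ i) ^ m"
      using Suc.IH by blast
    have "of_nat (Suc m) * g = lin_form (Q $ i) * dir_deriv (column i P) g"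
      unfolding Euler_identity_frame [OF PQ Suc.prems(1)]
      by (rule sum_eq_single) (simp_all add: Suc.prems(2))
    then have "of_nat (Suc m) * g = const_poly c * lin_form (Q $ i) ^ Suc m"
      by (simp add: c ac_simps)
    then have "g = const_poly (inverse (of_nat (Suc m)) * c) * lin_form (Q $ i) ^ Suc m"
      using const_poly_inverse_mult by (metis const_poly_mult mult.assoc)
    then show ?case by blast
  qed
  then show ?thesis using that by blast
qed

lemma column_nonzero: "column k P \<noteq> 0"
  using pairing [of k k] by auto

text \<open>The derivative along the dual basis vector \<open>column i P\<close> reads off the
  coefficient \<open>c i\<close>.\<close>

lemma lin_form_independent:
  assumes "(\<Sum>k\<in>UNIV. const_poly (c k) * lin_form (Q $ k)) = 0"
  shows "c i = 0"
proof -
  have "dir_deriv (column i P) (\<Sum>k\<in>UNIV. const_poly (c k) * lin_form (Q $ k)) =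
      (\<Sum>k\<in>UNIV. const_poly (c k) * const_poly (if i = k then 1 else 0))"
    by (simp only: dir_deriv_sum_right dir_deriv_const_mult dir_deriv_frame)
  also have "\<dots> = const_poly (c i)"
    by (subst sum_eq_single [of _ i]) auto
  finally show ?thesis by (simp add: assms)
qed

lemma diagonalizable_formI:
  assumes f: "f = (\<Sum>k\<in>UNIV. const_poly (c k) * lin_form (Q $ k) ^ d)" and c: "\<And>k. c k \<noteq> 0"
  shows "diagonalizable_form d f"
proof -
  obtain g :: "nat \<Rightarrow> 'n" where g: "bij_betw g {..<CARD('n)} UNIV"
    using finite_same_card_bij [of "{..<CARD('n)}" "UNIV :: 'n set"] by auto
  have reindex: "(\<Sum>i<CARD('n). F (g i)) = (\<Sum>k\<in>UNIV. F k)" for F :: "'n \<Rightarrow> 'n cpoly"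
    by (rule sum.reindex_bij_betw [OF g])
  have "lin_indep_forms CARD('n) (\<lambda>i. lin_form (Q $ g i))"
    unfolding lin_indep_forms_def
  proof (intro conjI allI impI)
    show "homogeneous 1 (lin_form (Q $ g i))" for i by (rule homogeneous_lin_form)
    fix b i
    assume sum: "(\<Sum>i<CARD('n). const_poly (b i) * lin_form (Q $ g i)) = 0" and i: "i < CARD('n)"
    define h where "h = inv_into {..<CARD('n)} g"
    have h: "h (g j) = j" if "j < CARD('n)" for j
      using g that by (simp add: h_def bij_betw_def)
    have "(\<Sum>k\<in>UNIV. const_poly (b (h k)) * lin_form (Q $ k)) = 0"
      unfolding reindex [symmetric] sum [symmetric] by (intro sum.cong) (simp_all add: h)
    then have "b (h (g i)) = 0" by (rule lin_form_independent)
    then show "b i = 0" by (simp add: h i)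
  qed
  moreover have "f = (\<Sum>i<CARD('n). const_poly (c (g i)) * lin_form (Q $ g i) ^ d)"
    by (simp add: f reindex [of "\<lambda>k. const_poly (c k) * lin_form (Q $ k) ^ d"])
  ultimately show ?thesis
    unfolding diagonalizable_form_def using c
    by (intro exI [of _ "CARD('n)"] exI [of _ "\<lambda>i. c (g i)"] exI [of _ "\<lambda>i. lin_form (Q $ g i)"]) simp
qed

lemma coordinate: "(Q *v w) $ k = (\<Sum>i\<in>UNIV. Q $ k $ i * w $ i)"
  by (simp add: matrix_vector_mult_def)

lemma coordinate_column: "(Q *v column j P) $ k = (if k = j then 1 else 0)"
  by (simp add: coordinate pairing)

lemma dir_deriv_power_sum:
  assumes f: "f = (\<Sum>k\<in>UNIV. const_poly (c k) * lin_form (Q $ k) ^ Suc m)"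
  shows "dir_deriv w f =
    (\<Sum>k\<in>UNIV. const_poly (c k * of_nat (Suc m) * (Q *v w) $ k) * lin_form (Q $ k) ^ m)"
  unfolding f dir_deriv_sum_right dir_deriv_const_mult dir_deriv_power dir_deriv_lin_form
    const_poly_mult const_poly_of_nat coordinate
  by (simp only: ac_simps)

text \<open>The derivative along \<open>column j P\<close> is a nonzero multiple of a power of the
  \<open>j\<close>-th coordinate. The exponent \<open>Suc (Suc m)\<close> keeps this power positive,
  so its vanishing forces the coordinate to vanish.\<close>

lemma smooth_power_sum:
  assumes f: "f = (\<Sum>k\<in>UNIV. const_poly (c k) * lin_form (Q $ k) ^ Suc (Suc m))" and c: "\<And>k. c k \<noteq> 0"
  shows "smooth_form f"
  unfolding smooth_form_def
proof (intro allI impI)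
  fix v assume v: "\<forall>i. eval_poly (partial_deriv i f) v = 0"
  have "(Q *v v) $ j = 0" for j
  proof -
    have "0 = eval_poly (dir_deriv (column j P) f) v"
      by (simp add: dir_deriv_def eval_poly_sum eval_poly_mult v)
    also have "\<dots> = (\<Sum>k\<in>UNIV. (c k * of_nat (Suc (Suc m)) * (Q *v column j P) $ k) * ((Q *v v) $ k) ^ Suc m)"
      unfolding dir_deriv_power_sum [OF f]
      by (simp add: eval_poly_sum eval_poly_mult eval_poly_power coordinate)
    also have "\<dots> = c j * of_nat (Suc (Suc m)) * ((Q *v v) $ j) ^ Suc m"
      by (subst sum_eq_single [of _ j]) (simp_all add: coordinate_column)
    finally show ?thesis
      using c [of j] by (auto simp del: of_nat_Suc)
  qed
  then have "Q *v v = 0" by (simp add: vec_eq_iff)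
  then have "P *v (Q *v v) = 0" by simp
  then show "v = 0" by (simp add: matrix_vector_mul_assoc PQ)
qed

text \<open>In the frame, each second derivative is a combination of the powers
  \<open>lin_form (Q $ k) ^ Suc m\<close>, with coefficients that are products of coordinates of the
  two directions. The exponent stays positive because the degree is at least 3, so evaluation at
  \<open>column j P\<close> singles out the \<open>j\<close>-th term.\<close>

lemma center_power_sum:
  assumes f: "f = (\<Sum>k\<in>UNIV. const_poly (c k) * lin_form (Q $ k) ^ Suc (Suc (Suc m)))"
    and c: "\<And>k. c k \<noteq> 0"
  shows "center f = conj_diagonals"
proof -
  define b where "b k = c k * of_nat (Suc (Suc (Suc m))) * of_nat (Suc (Suc m))" for k
  have b: "b k \<noteq> 0" for k using c [of k] by (simp add: b_def del: of_nat_Suc)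
  have second: "dir_deriv u (dir_deriv w f) =
      (\<Sum>k\<in>UNIV. const_poly (b k * ((Q *v u) $ k * (Q *v w) $ k)) * lin_form (Q $ k) ^ Suc m)" for u w
    unfolding dir_deriv_power_sum [OF dir_deriv_power_sum [OF f]] b_def by (simp only: ac_simps)
  have eval_second: "eval_poly (dir_deriv u (dir_deriv w f)) (column j P) =
      b j * ((Q *v u) $ j * (Q *v w) $ j)" for u w j
  proof -
    have "eval_poly (dir_deriv u (dir_deriv w f)) (column j P) =
        (\<Sum>k\<in>UNIV. b k * ((Q *v u) $ k * (Q *v w) $ k) * ((Q *v column j P) $ k) ^ Suc m)"
      unfolding second by (simp add: eval_poly_sum eval_poly_mult eval_poly_power coordinate)
    also have "\<dots> = b j * ((Q *v u) $ j * (Q *v w) $ j)"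
      by (subst sum_eq_single [of _ j]) (simp_all add: coordinate_column)
    finally show ?thesis .
  qed
  have entry: "(Q ** X ** P) $ i $ j = (Q *v (X *v column j P)) $ i" for X i j
    by (simp add: matrix_vector_mul_assoc) (simp add: matrix_mul_entry matrix_vector_mult_def column_def)
  show ?thesis
  proof (intro equalityI subsetI)
    fix X assume X: "X \<in> center f"
    have "(Q ** X ** P) $ i $ j = 0" if "i \<noteq> j" for i j
    proof -
      \<comment> \<open>Evaluated at \<open>column i P\<close>, the right side vanishes since
        \<open>column j P\<close> has \<open>i\<close>-th coordinate 0; the left side is
        \<open>b i\<close> times the entry at \<open>i\<close>, \<open>j\<close>.\<close>
      have "dir_deriv (X *v column j P) (dir_deriv (column i P) f) =
          dir_deriv (column j P) (dir_deriv (X *v column i P) f)"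
        by (rule center_swap [OF X])
      then have "b i * ((Q *v (X *v column j P)) $ i * (Q *v column i P) $ i) =
          b i * ((Q *v column j P) $ i * (Q *v (X *v column i P)) $ i)"
        using eval_second by metis
      then show ?thesis using b [of i] that by (simp add: coordinate_column entry)
    qed
    then show "X \<in> conj_diagonals" by (simp add: conj_diagonals_def is_diagonal_def)
  next
    fix X assume X: "X \<in> conj_diagonals"
    \<comment> \<open>Here \<open>X\<close> only scales each coordinate, and the scalar can be
      attached to either of the two directions.\<close>
    have act: "(Q *v (X *v u)) $ k = (Q ** X ** P) $ k $ k * (Q *v u) $ k" for u k
    proof -
      have "Q *v (X *v u) = (Q ** X ** P) *v (Q *v u)"
        by (simp add: matrix_vector_mul_assoc matrix_mul_assoc [symmetric] PQ)
      then have "(Q *v (X *v u)) $ k = (\<Sum>j\<in>UNIV. (Q ** X ** P) $ k $ j * (Q *v u) $ j)"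
        by (simp add: matrix_vector_mult_def)
      also have "\<dots> = (Q ** X ** P) $ k $ k * (Q *v u) $ k"
        using X by (intro sum_eq_single) (auto simp: conj_diagonals_def is_diagonal_def)
      finally show ?thesis .
    qed
    show "X \<in> center f"
      unfolding center_iff second act by (simp only: ac_simps) simp
  qed
qed

end

section \<open>Diagonalizability, idempotents and smoothness\<close>

context nondegenerate_form
begin

sublocale center: comm_matrix_algebra "center f"
  by unfold_locales
    (rule subspace_center center_mat_1 | erule (1) center_mult | erule (1) center_commute)+

text \<open>In the basis adapted to the idempotents the mixed second derivatives vanish. Each first
  derivative is therefore a multiple of a power of one coordinate, and Euler's identity in the frame
  assembles \<open>f\<close> from these powers.\<close>

lemma orthogonal_idempotents_imp_diagonalizable:
  fixes e :: "'n \<Rightarrow> complex^'n^'n"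
  assumes e: "orthogonal_idempotents e" "range e \<subseteq> center f"
  shows "diagonalizable_form d f"
proof -
  obtain P Q where PQ: "P ** Q = mat 1" "Q ** P = mat 1"
    and act: "\<And>i j. e i *v column j P = (if i = j then column j P else 0)"
    using orthogonal_idempotents_frame [OF e(1)] by blast
  interpret diagonal_frame P Q by unfold_locales (rule PQ)+
  have mixed: "dir_deriv (column j P) (dir_deriv (column i P) f) = 0" if "j \<noteq> i" for i j
  proof -
    have "e j \<in> center f" using e(2) by auto
    \<comment> \<open>The idempotent \<open>e j\<close> fixes \<open>column j P\<close> and kills
      \<open>column i P\<close>.\<close>
    from center_swap [OF this, of "column j P" "column i P"] show ?thesis
      using that by (simp add: act)
  qed
  obtain k where k: "d = Suc k" using degree by (cases d) auto
  have "\<exists>c. dir_deriv (column i P) f = const_poly c * lin_form (Q $ i) ^ k" for i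
  proof -
    have "homogeneous k (dir_deriv (column i P) f)"
      using homogeneous unfolding k by (rule homogeneous_dir_deriv)
    then show ?thesis using mixed power_of_coordinate by metis
  qed
  then obtain c where c: "\<And>i. dir_deriv (column i P) f = const_poly (c i) * lin_form (Q $ i) ^ k"
    by metis
  have "of_nat (Suc k) * f = (\<Sum>i\<in>UNIV. const_poly (c i) * lin_form (Q $ i) ^ d)"
    using Euler_identity_frame [OF PQ(1) homogeneous] by (simp add: k c ac_simps)
  then have "f = const_poly (inverse (of_nat (Suc k))) * (\<Sum>i\<in>UNIV. const_poly (c i) * lin_form (Q $ i) ^ d)"
    by (rule const_poly_inverse_mult)
  also have "\<dots> = (\<Sum>i\<in>UNIV. const_poly (inverse (of_nat (Suc k)) * c i) * lin_form (Q $ i) ^ d)"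
    by (simp only: sum_distrib_left const_poly_mult mult.assoc)
  finally show ?thesis
  proof (rule diagonalizable_formI)
    fix i
    \<comment> \<open>Otherwise the derivative of \<open>f\<close> along a basis vector would
      vanish, against nondegeneracy.\<close>
    have "c i \<noteq> 0"
      using c [of i] nondegenerate_dir_deriv [OF nondegenerate, of "column i P"] column_nonzero [of i] by auto
    then show "inverse (of_nat (Suc k)) * c i \<noteq> 0" by (simp del: of_nat_Suc)
  qed
qed

text \<open>Linear independence bounds the number \<open>r\<close> of summands by the number of
  variables. Nondegeneracy gives equality, since a vector on which all the linear forms vanish is a
  direction in which the derivative of \<open>f\<close> is zero.\<close>

lemma diagonalizable_imp_frame:
  assumes "diagonalizable_form d f"
  obtains P Q :: "complex^'n^'n" and c :: "'n \<Rightarrow> complex" where "diagonal_frame P Q" "\<And>k. c k \<noteq> 0"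
    "f = (\<Sum>k\<in>UNIV. const_poly (c k) * lin_form (Q $ k) ^ d)"
proof -
  obtain r lam l where lam: "\<And>i. i < r \<Longrightarrow> lam i \<noteq> 0" and ind: "lin_indep_forms r l"
    and f: "f = (\<Sum>i<r. const_poly (lam i) * l i ^ d)"
    using assms unfolding diagonalizable_form_def by blast
  have "\<exists>v. i < r \<longrightarrow> l i = lin_form v" for i
    using ind homogeneous_1_imp_lin_form unfolding lin_indep_forms_def by metis
  then obtain v where v: "\<And>i. i < r \<Longrightarrow> l i = lin_form (v i)" by metis
  have zero: "b i = 0" if "(\<Sum>i<r. b i *s v i) = 0" "i < r" for b i
  proof -
    have "(\<Sum>i<r. const_poly (b i) * l i) = (\<Sum>i<r. const_poly (b i) * lin_form (v i))"
      using v by simp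
    also have "\<dots> = lin_form (\<Sum>i<r. b i *s v i)"
      by (simp add: lin_form_def sum_distrib_left sum_distrib_right const_poly_sum const_poly_mult mult.assoc)
        (rule sum.swap)
    also have "\<dots> = 0" by (simp add: that lin_form_def)
    finally show ?thesis using ind that(2) unfolding lin_indep_forms_def by blast
  qed
  have inj: "inj_on v {..<r}"
  proof (rule inj_onI, rule ccontr)
    fix i j assume ij: "i \<in> {..<r}" "j \<in> {..<r}" "v i = v j" "i \<noteq> j"
    \<comment> \<open>Equal vectors at different indices would give the nontrivial relation
      \<open>v i - v j = 0\<close>.\<close>
    have "(\<Sum>k<r. (if k = i then 1 else if k = j then -1 else 0) *s v k) =
        (\<Sum>k<r. (if k = i then v i else 0) - (if k = j then v j else 0))"
      using ij(4) by (intro sum.cong) (auto simp: vec_eq_iff)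
    also have "\<dots> = 0" using ij by (simp add: sum_subtractf)
    finally have "(if i = i then 1 else if i = j then -1 else 0) = (0::complex)"
      using ij(1) by (intro zero) auto
    then show False by simp
  qed
  have "vec.independent (v ` {..<r})"
  proof (rule vec.independent_if_scalars_zero)
    fix u x
    assume sum: "(\<Sum>x\<in>v ` {..<r}. u x *s x) = 0" and "x \<in> v ` {..<r}"
    then obtain i where i: "x = v i" "i < r" by auto
    have "(\<Sum>i<r. u (v i) *s v i) = 0" using sum by (simp add: sum.reindex [OF inj])
    then show "u x = 0" using zero [of "\<lambda>i. u (v i)"] i by blast
  qed simp
  then have "card (v ` {..<r}) \<le> CARD('n)"
    using vec.independent_card_le_dim [OF subset_UNIV] by (simp add: card_cart_basis)
  then have r: "card {..<r} \<le> card (UNIV :: 'n set)" by (simp add: card_image [OF inj])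
  obtain g :: "nat \<Rightarrow> 'n" where g: "inj_on g {..<r}"
    using card_le_inj [OF _ _ r] by auto
  define h where "h = inv_into {..<r} g"
  have hg: "h (g i) = i" if "i < r" for i using g that by (simp add: h_def)
  \<comment> \<open>Row \<open>g i\<close> holds the coefficients of \<open>l i\<close>. The other
    rows are padded with zeros until invertibility of \<open>Q\<close> shows that there are
    none.\<close>
  define Q :: "complex^'n^'n" where "Q = (\<chi> k. if k \<in> g ` {..<r} then v (h k) else 0)"
  have Qg: "Q $ g i = v i" if "i < r" for i using that hg by (simp add: Q_def)
  obtain m where m: "d = Suc m" using degree by (cases d) auto
  have "w = 0" if w: "Q *v w = 0" for w
  proof -
    have "(Q *v w) $ g i = (\<Sum>a\<in>UNIV. v i $ a * w $ a)" if "i < r" for i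
      by (simp add: matrix_vector_mult_def Qg [OF that])
    then have "(\<Sum>a\<in>UNIV. v i $ a * w $ a) = 0" if "i < r" for i
      using w that by simp
    then have "dir_deriv w f = 0"
      by (simp add: f m dir_deriv_sum_right dir_deriv_const_mult dir_deriv_power dir_deriv_lin_form v del: power_Suc)
    then show ?thesis using nondegenerate_dir_deriv nondegenerate by blast
  qed
  then have "invertible Q"
    by (metis invertible_left_inverse matrix_left_invertible_ker)
  then obtain P where PQ: "P ** Q = mat 1" "Q ** P = mat 1"
    unfolding invertible_def by blast
  have "k \<in> g ` {..<r}" for k
  proof (rule ccontr)
    assume "k \<notin> g ` {..<r}"
    then have "(Q ** P) $ k $ k = 0" by (simp add: matrix_mul_entry Q_def)
    then show False by (simp add: PQ mat_def)
  qed
  then have bij: "bij_betw g {..<r} UNIV" using g by (auto simp: bij_betw_def)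
  have "(\<Sum>k\<in>UNIV. const_poly (lam (h k)) * lin_form (Q $ k) ^ d) =
      (\<Sum>i<r. const_poly (lam (h (g i))) * lin_form (Q $ g i) ^ d)"
    by (rule sum.reindex_bij_betw [OF bij, symmetric])
  then have f_eq: "f = (\<Sum>k\<in>UNIV. const_poly (lam (h k)) * lin_form (Q $ k) ^ d)"
    by (simp add: f hg Qg v)
  have nonzero: "lam (h k) \<noteq> 0" for k
    using bij lam by (metis bij_betw_imp_surj_on hg imageE lessThan_iff UNIV_I)
  have "diagonal_frame P Q" by unfold_locales (rule PQ)+
  then show ?thesis using nonzero f_eq by (rule that)
qed

text \<open>For \<open>y = X *v v\<close>, moving \<open>X\<close> from the first \<open>y\<close>
  to the second turns \<open>D y (D y (D w f))\<close> into a derivative along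
  \<open>X *v y = 0\<close>. Evaluating at \<open>y\<close> and applying Euler's identity twice,
  with the nonzero factors \<open>d - 2\<close> and \<open>d - 1\<close>, gives
  \<open>D w f = 0\<close> at \<open>y\<close>, so \<open>y\<close> is a singular point.\<close>

lemma smooth_imp_reduced:
  assumes "smooth_form f"
  shows center.reduced
  unfolding center.reduced_def
proof (intro ballI impI)
  fix X assume X: "X \<in> center f" "X ** X = 0"
  obtain k where k: "d = Suc (Suc (Suc k))"
    using degree le_Suc_ex [of 3 d] by (auto simp: numeral_3_eq_3)
  have "X *v v = 0" for v
  proof -
    let ?y = "X *v v"
    have "eval_poly (dir_deriv w f) ?y = 0" for w
    proof -
      have hom: "homogeneous (Suc (Suc k)) (dir_deriv w f)"
        using homogeneous unfolding k by (rule homogeneous_dir_deriv)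
      have "X *v ?y = 0" by (simp add: matrix_vector_mul_assoc X)
      then have "dir_deriv ?y (dir_deriv ?y (dir_deriv w f)) = 0"
        by (simp add: center_swap3 [OF X(1)])
      then have "of_nat (Suc k) * (of_nat (Suc (Suc k)) * eval_poly (dir_deriv w f) ?y) = 0"
        using Euler_identity_eval [OF homogeneous_dir_deriv [OF hom], of ?y ?y]
          Euler_identity_eval [OF hom, of ?y] by simp
      then show ?thesis by (simp del: of_nat_Suc)
    qed
    then have "\<forall>i. eval_poly (partial_deriv i f) ?y = 0" by (metis dir_deriv_axis)
    then show ?thesis using assms by (simp add: smooth_form_def)
  qed
  then show "X = 0" by (simp add: matrix_eq)
qed

end

section \<open>Equivalence of the six conditions\<close>

theorem theorem4p3:
  fixes f :: "'n::finite cpoly" and d :: nat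
  assumes "d \<ge> 3"
    and "homogeneous d f"
    and "nondegenerate f"
  shows
    "(diagonalizable_form d f \<longleftrightarrow> cmat_alg_isomorphic (center f) diagonal_algebra) \<and>
     (diagonalizable_form d f \<longleftrightarrow> smooth_form f \<and> cmat.dim (center f) = CARD('n)) \<and>
     (diagonalizable_form d f \<longleftrightarrow> semisimple_algebra (center f) \<and> cmat.dim (center f) = CARD('n)) \<and>
     (diagonalizable_form d f \<longleftrightarrow>
        cmat.dim (center f) = CARD('n) \<and>
        (\<forall>B. cmat_basis B (center f) \<longrightarrow> (\<forall>X\<in>B. diagonalizable_matrix X))) \<and>
     (diagonalizable_form d f \<longleftrightarrow>
        cmat.dim (center f) = CARD('n) \<and>
        (\<exists>B. cmat_basis B (center f) \<and> (\<forall>X\<in>B. rank X = 1 \<and> trace X = 1)))"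
proof -
  interpret nondegenerate_form d f by unfold_locales (rule assms)+
  let ?two = "cmat_alg_isomorphic (center f) diagonal_algebra"
  let ?dim = "cmat.dim (center f) = CARD('n)"
  let ?five = "\<forall>B. cmat_basis B (center f) \<longrightarrow> (\<forall>X\<in>B. diagonalizable_matrix X)"
  let ?six = "\<exists>B. cmat_basis B (center f) \<and> (\<forall>X\<in>B. rank X = 1 \<and> trace X = 1)"
  have consequences: "?two \<and> smooth_form f \<and> semisimple_algebra (center f) \<and> ?dim \<and> ?five \<and> ?six"
    if diag: "diagonalizable_form d f"
  proof -
    obtain P Q :: "complex^'n^'n" and c :: "'n \<Rightarrow> complex" where frame: "diagonal_frame P Q" and c: "\<And>k. c k \<noteq> 0"
      and f: "f = (\<Sum>k\<in>UNIV. const_poly (c k) * lin_form (Q $ k) ^ d)"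
      by (rule diagonalizable_imp_frame [OF diag]) (rule that)
    interpret diagonal_frame P Q by (rule frame)
    obtain m where m: "d = Suc (Suc (Suc m))"
      using assms(1) le_Suc_ex [of 3 d] by (auto simp: numeral_3_eq_3)
    \<comment> \<open>Apart from smoothness, everything to be derived is now a statement about the
      explicit algebra \<open>conj_diagonals\<close>.\<close>
    have center: "center f = conj_diagonals"
      using center_power_sum f c unfolding m by blast
    have "smooth_form f"
      using smooth_power_sum f c unfolding m by blast
    moreover have ?five
      using conj_diagonals_diagonalizable by (auto simp: center cmat_basis_def)
    moreover have ?six
      unfolding center by (rule exI [of _ "range idem"]) (auto simp: cmat_basis_idem rank_idem trace_idem)
    ultimately show ?thesis
      using conj_diagonals_isomorphic conj_diagonals_semisimple dim_conj_diagonals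
      unfolding center by blast
  qed
  \<comment> \<open>Conditions (3), (4) and (5) share this route and differ only in the reason for
    reducedness.\<close>
  have reduced: "diagonalizable_form d f" if ?dim center.reduced
    using center.exists_orthogonal_idempotents [OF that] orthogonal_idempotents_imp_diagonalizable by blast
  have "diagonalizable_form d f" if ?two
    using center.isomorphic_imp_orthogonal_idempotents [OF that]
      orthogonal_idempotents_imp_diagonalizable by blast
  moreover have "diagonalizable_form d f" if "smooth_form f" ?dim
    using reduced that smooth_imp_reduced by blast
  moreover have "diagonalizable_form d f" if "semisimple_algebra (center f)" ?dim
    using reduced that center.semisimple_imp_reduced by blast
  moreover have "diagonalizable_form d f" if ?five ?dim
    using reduced that center.diagonalizable_bases_imp_reduced by blast
  moreover have "diagonalizable_form d f" if six: ?six and dim: ?dim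
  proof -
    obtain B where B: "cmat_basis B (center f)" "\<And>X. X \<in> B \<Longrightarrow> rank X = 1 \<and> trace X = 1"
      using six by blast
    show ?thesis
      using center.rank_1_basis_imp_orthogonal_idempotents [OF dim B]
        orthogonal_idempotents_imp_diagonalizable by blast
  qed
  ultimately show ?thesis using consequences by argo
qed

end
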